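(* Let $C$ be a set and let $\{R^{(c)}\}_{c\in C}$ be a family of R-matrices for the same bialgebra $(B,\Delta)$. Then for all pairwise distinct $i,j,k\in\{1,\dots,n\}$ and all $c,c',c''\in C$ with $c'\in\{c,c''\}$, $$R_{j,k}^{(c)}R_{i,k}^{(c')}R_{i,j}^{(c'')}=R_{i,j}^{(c'')}R_{i,k}^{(c')}R_{j,k}^{(c)}$$ in $B^{\widehat\otimes n}$.
   Context: Algebras are unital associative over a field of characteristic zero. $B^{\widehat\otimes m}$ denotes $B^{\otimes m}$ or a suitable completion: an algebra containing $B^{\otimes m}$ such that leg embeddings, permutations of factors, and comultiplication or counit applied to a factor extend to these algebras as algebra homomorphisms, with the usual identities among them preserved. For $X\in B\widehat\otimes B$ and distinct $i,j$, $X_{i,j}\in B^{\widehat\otimes n}$ has the first factor of $X$ in position $i$, the second in position $j$, and $1$ elsewhere. An R-matrix for $(B,\Delta)$ is an invertible $R\in B\widehat\otimes B$ with $\tau(\Delta(b))=R\Delta(b)R^{-1}$ for all $b\in B$ ($\tau$ the flip of factors), $(\Delta\otimes\mathrm{id})(R)=R_{1,3}R_{2,3}$ and $(\mathrm{id}\otimes\Delta)(R)=R_{1,3}R_{1,2}$.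
   Formalization: The completion is also assumed to preserve every relation uφ(x)=ψ(x)u (φ, ψ composites of the structural maps, u any element) that holds on the uncompleted tensor powers; without some such condition the claim fails, and it holds for B^{⊗m} and for dense continuous completions. *)

theory Defs
  imports "HOL-Algebra.Module" "HOL-Combinatorics.Transposition"
begin

section \<open>Associative algebras over a field of characteristic zero\<close>

locale field_char_zero = field K for K (structure) +
  assumes char_zero: "(n::nat) > 0 \<Longrightarrow> [n] \<cdot> \<one> \<noteq> \<zero>"

text \<open>The library locale \<^locale>\<open>algebra\<close> only covers commutative algebras.\<close>

locale assoc_algebra = K: field_char_zero K + module K A + A: ring A
  for K (structure) and A (structure) +
  assumes smult_mult_left:
      "\<lbrakk>c \<in> carrier K; x \<in> carrier A; y \<in> carrier A\<rbrakk> \<Longrightarrow>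
        (c \<odot>\<^bsub>A\<^esub> x) \<otimes>\<^bsub>A\<^esub> y = c \<odot>\<^bsub>A\<^esub> (x \<otimes>\<^bsub>A\<^esub> y)"
    and smult_mult_right:
      "\<lbrakk>c \<in> carrier K; x \<in> carrier A; y \<in> carrier A\<rbrakk> \<Longrightarrow>
        x \<otimes>\<^bsub>A\<^esub> (c \<odot>\<^bsub>A\<^esub> y) = c \<odot>\<^bsub>A\<^esub> (x \<otimes>\<^bsub>A\<^esub> y)"

definition algebra_hom ::
    "'k ring \<Rightarrow> ('k, 'a) module \<Rightarrow> ('k, 'b) module \<Rightarrow> ('a \<Rightarrow> 'b) set"
  where "algebra_hom K A A' =
    {h \<in> ring_hom A A'. \<forall>c\<in>carrier K. \<forall>x\<in>carrier A. h (c \<odot>\<^bsub>A\<^esub> x) = c \<odot>\<^bsub>A'\<^esub> h x}"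


section \<open>Algebraic tensor powers\<close>

text \<open>A list of pairs \<open>(c, [b\<^sub>1, \<dots>, b\<^sub>m])\<close> stands for the formal sum of the
  \<open>c (b\<^sub>1 \<otimes> \<dots> \<otimes> b\<^sub>m)\<close>. The \<open>m\<close>-th tensor power of \<open>B\<close> is the quotient of the set of
  formal sums by the relations of multilinearity; for \<open>m = 0\<close> it is the ground field.\<close>

type_synonym ('k, 'b) formal_sum = "('k \<times> 'b list) list"

definition tensor_words :: "('k, 'b) module \<Rightarrow> nat \<Rightarrow> 'b list set"
  where "tensor_words B m = {w \<in> lists (carrier B). length w = m}"

definition formal_sums ::
    "'k ring \<Rightarrow> ('k, 'b) module \<Rightarrow> nat \<Rightarrow> ('k, 'b) formal_sum set"
  where "formal_sums K B m = lists (carrier K \<times> tensor_words B m)"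

inductive tensor_eq ::
    "'k ring \<Rightarrow> ('k, 'b) module \<Rightarrow> nat \<Rightarrow> ('k, 'b) formal_sum \<Rightarrow> ('k, 'b) formal_sum \<Rightarrow> bool"
  for K :: "'k ring" and B :: "('k, 'b) module" and m :: nat
  where
    refl: "s \<in> formal_sums K B m \<Longrightarrow> tensor_eq K B m s s"
  | sym: "tensor_eq K B m s t \<Longrightarrow> tensor_eq K B m t s"
  | trans: "tensor_eq K B m s t \<Longrightarrow> tensor_eq K B m t u \<Longrightarrow> tensor_eq K B m s u"
  | append: "tensor_eq K B m s s' \<Longrightarrow> tensor_eq K B m t t' \<Longrightarrow> tensor_eq K B m (s @ t) (s' @ t')"
  | comm: "s \<in> formal_sums K B m \<Longrightarrow> t \<in> formal_sums K B m \<Longrightarrow> tensor_eq K B m (s @ t) (t @ s)"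
  | coeff_zero: "w \<in> tensor_words B m \<Longrightarrow> tensor_eq K B m [(\<zero>\<^bsub>K\<^esub>, w)] []"
  | coeff_add: "c \<in> carrier K \<Longrightarrow> d \<in> carrier K \<Longrightarrow> w \<in> tensor_words B m \<Longrightarrow>
      tensor_eq K B m [(c \<oplus>\<^bsub>K\<^esub> d, w)] [(c, w), (d, w)]"
  | letter_add: "c \<in> carrier K \<Longrightarrow> a \<in> carrier B \<Longrightarrow> b \<in> carrier B \<Longrightarrow>
      u \<in> lists (carrier B) \<Longrightarrow> v \<in> lists (carrier B) \<Longrightarrow> length u + 1 + length v = m \<Longrightarrow>
      tensor_eq K B m [(c, u @ (a \<oplus>\<^bsub>B\<^esub> b) # v)] [(c, u @ a # v), (c, u @ b # v)]"
  | letter_smult: "c \<in> carrier K \<Longrightarrow> d \<in> carrier K \<Longrightarrow> a \<in> carrier B \<Longrightarrow>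
      u \<in> lists (carrier B) \<Longrightarrow> v \<in> lists (carrier B) \<Longrightarrow> length u + 1 + length v = m \<Longrightarrow>
      tensor_eq K B m [(c, u @ (d \<odot>\<^bsub>B\<^esub> a) # v)] [(c \<otimes>\<^bsub>K\<^esub> d, u @ a # v)]"

definition tensor_rel ::
    "'k ring \<Rightarrow> ('k, 'b) module \<Rightarrow> nat \<Rightarrow> (('k, 'b) formal_sum \<times> ('k, 'b) formal_sum) set"
  where "tensor_rel K B m = {(s, t). tensor_eq K B m s t}"

definition tensor_class ::
    "'k ring \<Rightarrow> ('k, 'b) module \<Rightarrow> nat \<Rightarrow> ('k, 'b) formal_sum \<Rightarrow> ('k, 'b) formal_sum set"
  where "tensor_class K B m s = tensor_rel K B m `` {s}"

definition formal_mult ::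
    "'k ring \<Rightarrow> ('k, 'b) module \<Rightarrow> ('k, 'b) formal_sum \<Rightarrow> ('k, 'b) formal_sum \<Rightarrow>
      ('k, 'b) formal_sum"
  where "formal_mult K B s t =
    [(c \<otimes>\<^bsub>K\<^esub> d, map2 (\<otimes>\<^bsub>B\<^esub>) v w). (c, v) \<leftarrow> s, (d, w) \<leftarrow> t]"

definition tensor_power ::
    "'k ring \<Rightarrow> ('k, 'b) module \<Rightarrow> nat \<Rightarrow> ('k, ('k, 'b) formal_sum set) module"
  where "tensor_power K B m =
    \<lparr>carrier = formal_sums K B m // tensor_rel K B m,
     monoid.mult = (\<lambda>X Y. \<Union>s\<in>X. \<Union>t\<in>Y. tensor_class K B m (formal_mult K B s t)),
     one = tensor_class K B m [(\<one>\<^bsub>K\<^esub>, replicate m \<one>\<^bsub>B\<^esub>)],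
     zero = tensor_class K B m [],
     add = (\<lambda>X Y. \<Union>s\<in>X. \<Union>t\<in>Y. tensor_class K B m (s @ t)),
     smult = (\<lambda>c X. \<Union>s\<in>X. tensor_class K B m [(c \<otimes>\<^bsub>K\<^esub> d, w). (d, w) \<leftarrow> s])\<rparr>"

text \<open>The linear map out of a tensor power that is given on formal sums by \<open>F\<close>.\<close>

definition tensor_lift ::
    "'k ring \<Rightarrow> ('k, 'b) module \<Rightarrow> nat \<Rightarrow>
      (('k, 'b) formal_sum \<Rightarrow> ('k, 'b) formal_sum) \<Rightarrow>
      ('k, 'b) formal_sum set \<Rightarrow> ('k, 'b) formal_sum set"
  where "tensor_lift K B n F X = (\<Union>s\<in>X. tensor_class K B n (F s))"

text \<open>The factors are numbered from 1, so the \<open>s\<close>-th factor of the word \<open>w\<close> is \<open>w ! (s - 1)\<close>.\<close>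

text \<open>For \<open>f\<close> injective from \<open>{1..m}\<close> to \<open>{1..n}\<close>: the factor in position \<open>s\<close> is moved to
  position \<open>f s\<close>, and \<open>1\<close> is put in the remaining positions. For \<open>m = n\<close> these are the
  permutations of the factors.\<close>

definition tensor_leg ::
    "'k ring \<Rightarrow> ('k, 'b) module \<Rightarrow> nat \<Rightarrow> nat \<Rightarrow> (nat \<Rightarrow> nat) \<Rightarrow>
      ('k, 'b) formal_sum set \<Rightarrow> ('k, 'b) formal_sum set"
  where "tensor_leg K B m n f = tensor_lift K B n (\<lambda>s.
    [(c, map (\<lambda>p. if p \<in> f ` {1..m} then w ! (inv_into {1..m} f p - 1) else \<one>\<^bsub>B\<^esub>) [1..<Suc n]).
      (c, w) \<leftarrow> s])"

text \<open>The comultiplication applied to the factor \<open>i\<close>, for \<open>1 \<le> i \<le> m\<close>. The choice of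
  a formal sum in the class \<open>\<Delta> b\<close> does not affect the resulting class.\<close>

definition tensor_comult ::
    "'k ring \<Rightarrow> ('k, 'b) module \<Rightarrow> ('b \<Rightarrow> ('k, 'b) formal_sum set) \<Rightarrow> nat \<Rightarrow> nat \<Rightarrow>
      ('k, 'b) formal_sum set \<Rightarrow> ('k, 'b) formal_sum set"
  where "tensor_comult K B \<Delta> m i = tensor_lift K B (m + 1) (\<lambda>s.
    [(c \<otimes>\<^bsub>K\<^esub> d, take (i - 1) w @ v @ drop i w).
      (c, w) \<leftarrow> s, (d, v) \<leftarrow> (SOME t. t \<in> \<Delta> (w ! (i - 1)))])"

definition tensor_counit ::
    "'k ring \<Rightarrow> ('k, 'b) module \<Rightarrow> ('b \<Rightarrow> 'k) \<Rightarrow> nat \<Rightarrow> nat \<Rightarrow>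
      ('k, 'b) formal_sum set \<Rightarrow> ('k, 'b) formal_sum set"
  where "tensor_counit K B \<epsilon> m i = tensor_lift K B (m - 1) (\<lambda>s.
    [(c \<otimes>\<^bsub>K\<^esub> \<epsilon> (w ! (i - 1)), take (i - 1) w @ drop i w). (c, w) \<leftarrow> s])"


section \<open>Bialgebras\<close>

locale bialgebra = assoc_algebra K B
  for K :: "'k ring" (structure) and B :: "('k, 'b) module" (structure) +
  fixes \<Delta> :: "'b \<Rightarrow> ('k, 'b) formal_sum set" and \<epsilon> :: "'b \<Rightarrow> 'k"
  assumes comult_hom: "\<Delta> \<in> algebra_hom K B (tensor_power K B 2)"
    and counit_hom: "\<epsilon> \<in> ring_hom B K"
    and counit_smult: "\<lbrakk>c \<in> carrier K; b \<in> carrier B\<rbrakk> \<Longrightarrow> \<epsilon> (c \<odot>\<^bsub>B\<^esub> b) = c \<otimes>\<^bsub>K\<^esub> \<epsilon> b"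
    and coassoc: "b \<in> carrier B \<Longrightarrow>
      tensor_comult K B \<Delta> 2 1 (\<Delta> b) = tensor_comult K B \<Delta> 2 2 (\<Delta> b)"
    and counit_left: "b \<in> carrier B \<Longrightarrow>
      tensor_counit K B \<epsilon> 2 1 (\<Delta> b) = tensor_class K B 1 [(\<one>\<^bsub>K\<^esub>, [b])]"
    and counit_right: "b \<in> carrier B \<Longrightarrow>
      tensor_counit K B \<epsilon> 2 2 (\<Delta> b) = tensor_class K B 1 [(\<one>\<^bsub>K\<^esub>, [b])]"


section \<open>Completed tensor powers\<close>

text \<open>The maps \<open>leg m n f\<close> (leg embeddings and permutations of factors),
  \<open>comult m i\<close> and \<open>counit m i\<close> (comultiplication and counit applied to the factor \<open>i\<close>)
  on the algebras \<open>T m\<close>, and their composites.\<close>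

inductive structural ::
    "(nat \<Rightarrow> nat \<Rightarrow> (nat \<Rightarrow> nat) \<Rightarrow> 'a \<Rightarrow> 'a) \<Rightarrow> (nat \<Rightarrow> nat \<Rightarrow> 'a \<Rightarrow> 'a) \<Rightarrow>
      (nat \<Rightarrow> nat \<Rightarrow> 'a \<Rightarrow> 'a) \<Rightarrow> nat \<Rightarrow> nat \<Rightarrow> ('a \<Rightarrow> 'a) \<Rightarrow> bool"
  for leg :: "nat \<Rightarrow> nat \<Rightarrow> (nat \<Rightarrow> nat) \<Rightarrow> 'a \<Rightarrow> 'a"
    and comult counit :: "nat \<Rightarrow> nat \<Rightarrow> 'a \<Rightarrow> 'a"
  where
    ident: "structural leg comult counit m m (\<lambda>x. x)"
  | leg: "inj_on f {1..m} \<Longrightarrow> f ` {1..m} \<subseteq> {1..n} \<Longrightarrow>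
      structural leg comult counit m n (leg m n f)"
  | comult: "i \<in> {1..m} \<Longrightarrow> structural leg comult counit m (m + 1) (comult m i)"
  | counit: "i \<in> {1..m} \<Longrightarrow> structural leg comult counit m (m - 1) (counit m i)"
  | comp: "structural leg comult counit l m \<phi> \<Longrightarrow> structural leg comult counit m n \<psi> \<Longrightarrow>
      structural leg comult counit l n (\<psi> \<circ> \<phi>)"

text \<open>The algebra \<open>T m\<close> contains the \<open>m\<close>-th tensor power of \<open>B\<close> through \<open>\<iota> m\<close>. The assumption
  \<open>identities_preserved\<close> says that an identity \<open>u (\<phi> x) = (\<psi> x) u\<close> between composites \<open>\<phi>\<close>, \<open>\<psi>\<close> of
  the extended maps holds on \<open>T m\<close> as soon as it holds on the tensor power. For \<open>u = 1\<close> these are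
  the identities among the maps themselves. The element \<open>u\<close> is allowed because two relations that
  hold in the tensor powers have to be available for elements of the completions: elements in
  disjoint legs commute, and \<open>R (\<Delta> b) = \<tau> (\<Delta> b) R\<close> holds with \<open>\<Delta>\<close> and \<open>\<tau> \<circ> \<Delta>\<close> applied to one
  factor. Without them a completion need not satisfy the Yang-Baxter equation. The assumption
  holds in the uncompleted case, and whenever the tensor powers are dense in Hausdorff algebras
  \<open>T m\<close> with separately continuous multiplication and the maps are continuous.\<close>

locale completed_tensor_powers = bialgebra K B \<Delta> \<epsilon>
  for K :: "'k ring" (structure) and B :: "('k, 'b) module" (structure)
    and \<Delta> :: "'b \<Rightarrow> ('k, 'b) formal_sum set" and \<epsilon> :: "'b \<Rightarrow> 'k" +
  fixes T :: "nat \<Rightarrow> ('k, 'a) module"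
    and \<iota> :: "nat \<Rightarrow> ('k, 'b) formal_sum set \<Rightarrow> 'a"
    and leg :: "nat \<Rightarrow> nat \<Rightarrow> (nat \<Rightarrow> nat) \<Rightarrow> 'a \<Rightarrow> 'a"
    and comult counit :: "nat \<Rightarrow> nat \<Rightarrow> 'a \<Rightarrow> 'a"
  assumes completion_algebra: "assoc_algebra K (T m)"
    and inclusion_hom: "\<iota> m \<in> algebra_hom K (tensor_power K B m) (T m)"
    and inclusion_inj: "inj_on (\<iota> m) (carrier (tensor_power K B m))"
    and leg_hom: "\<lbrakk>inj_on f {1..m}; f ` {1..m} \<subseteq> {1..n}\<rbrakk> \<Longrightarrow>
      leg m n f \<in> algebra_hom K (T m) (T n)"
    and leg_extends:
      "\<lbrakk>inj_on f {1..m}; f ` {1..m} \<subseteq> {1..n}; x \<in> carrier (tensor_power K B m)\<rbrakk> \<Longrightarrow>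
        leg m n f (\<iota> m x) = \<iota> n (tensor_leg K B m n f x)"
    and comult_hom': "i \<in> {1..m} \<Longrightarrow> comult m i \<in> algebra_hom K (T m) (T (m + 1))"
    and comult_extends: "\<lbrakk>i \<in> {1..m}; x \<in> carrier (tensor_power K B m)\<rbrakk> \<Longrightarrow>
      comult m i (\<iota> m x) = \<iota> (m + 1) (tensor_comult K B \<Delta> m i x)"
    and counit_hom': "i \<in> {1..m} \<Longrightarrow> counit m i \<in> algebra_hom K (T m) (T (m - 1))"
    and counit_extends: "\<lbrakk>i \<in> {1..m}; x \<in> carrier (tensor_power K B m)\<rbrakk> \<Longrightarrow>
      counit m i (\<iota> m x) = \<iota> (m - 1) (tensor_counit K B \<epsilon> m i x)"
    and identities_preserved:
      "\<lbrakk>structural leg comult counit m n \<phi>; structural leg comult counit m n \<psi>;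
        u \<in> carrier (T n);
        \<And>x. x \<in> carrier (tensor_power K B m) \<Longrightarrow>
          u \<otimes>\<^bsub>T n\<^esub> \<phi> (\<iota> m x) = \<psi> (\<iota> m x) \<otimes>\<^bsub>T n\<^esub> u;
        X \<in> carrier (T m)\<rbrakk> \<Longrightarrow>
        u \<otimes>\<^bsub>T n\<^esub> \<phi> X = \<psi> X \<otimes>\<^bsub>T n\<^esub> u"


section \<open>R-matrices\<close>

text \<open>\<open>at_legs leg n i j X\<close> is the element \<open>X\<^sub>i\<^sub>,\<^sub>j\<close> of \<open>T n\<close>.\<close>

definition at_legs ::
    "(nat \<Rightarrow> nat \<Rightarrow> (nat \<Rightarrow> nat) \<Rightarrow> 'a \<Rightarrow> 'a) \<Rightarrow> nat \<Rightarrow> nat \<Rightarrow> nat \<Rightarrow> 'a \<Rightarrow> 'a"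
  where "at_legs leg n i j = leg 2 n (\<lambda>s. if s = 1 then i else j)"

definition R_matrix ::
    "('k, 'b) module \<Rightarrow> ('b \<Rightarrow> ('k, 'b) formal_sum set) \<Rightarrow> (nat \<Rightarrow> ('k, 'a) module) \<Rightarrow>
      (nat \<Rightarrow> ('k, 'b) formal_sum set \<Rightarrow> 'a) \<Rightarrow>
      (nat \<Rightarrow> nat \<Rightarrow> (nat \<Rightarrow> nat) \<Rightarrow> 'a \<Rightarrow> 'a) \<Rightarrow> (nat \<Rightarrow> nat \<Rightarrow> 'a \<Rightarrow> 'a) \<Rightarrow> 'a \<Rightarrow> bool"
  where "R_matrix B \<Delta> T \<iota> leg comult R \<longleftrightarrow>
    R \<in> Units (T 2) \<and>
    (\<forall>b\<in>carrier B. leg 2 2 (transpose 1 2) (\<iota> 2 (\<Delta> b)) =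
      R \<otimes>\<^bsub>T 2\<^esub> \<iota> 2 (\<Delta> b) \<otimes>\<^bsub>T 2\<^esub> inv\<^bsub>T 2\<^esub> R) \<and>
    comult 2 1 R = at_legs leg 3 1 3 R \<otimes>\<^bsub>T 3\<^esub> at_legs leg 3 2 3 R \<and>
    comult 2 2 R = at_legs leg 3 1 3 R \<otimes>\<^bsub>T 3\<^esub> at_legs leg 3 1 2 R"

end

theory Submission
  imports Defs
begin

text \<open>The intertwining relation of an R-matrix \<open>S\<close>, applied to the first two legs, says
  \<open>S\<^sub>1\<^sub>2 \<cdot> (\<Delta> \<otimes> id)(X) = (\<tau>\<Delta> \<otimes> id)(X) \<cdot> S\<^sub>1\<^sub>2\<close>. For another R-matrix \<open>R\<close> of the same
  bialgebra, \<open>(\<Delta> \<otimes> id)(R) = R\<^sub>1\<^sub>3 R\<^sub>2\<^sub>3\<close>, so \<open>X = R\<close> gives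
  \<open>S\<^sub>1\<^sub>2 R\<^sub>1\<^sub>3 R\<^sub>2\<^sub>3 = R\<^sub>2\<^sub>3 R\<^sub>1\<^sub>3 S\<^sub>1\<^sub>2\<close>. The last two legs and
  \<open>(id \<otimes> \<Delta>)(R) = R\<^sub>1\<^sub>3 R\<^sub>1\<^sub>2\<close> give the case in which the first factor is the different one.
  The leg embedding sending \<open>1, 2, 3\<close> to \<open>i, j, k\<close> then carries both equations over to
  \<open>n\<close> factors.\<close>

section \<open>Maps on tensor powers given on formal sums\<close>

locale tensor_powers = assoc_algebra K A
  for K :: "'k ring" (structure) and A :: "('k, 'b) module" (structure)
begin

section \<open>Formal sums and maps compatible with multilinearity\<close>

lemma formal_sums_simps [simp]:
  "[] \<in> formal_sums K A m"
  "(c, w) # s \<in> formal_sums K A m \<longleftrightarrow>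
    c \<in> carrier K \<and> w \<in> tensor_words A m \<and> s \<in> formal_sums K A m"
  "s @ t \<in> formal_sums K A m \<longleftrightarrow> s \<in> formal_sums K A m \<and> t \<in> formal_sums K A m"
  by (auto simp: formal_sums_def)

lemma formal_sums_memD:
  assumes "s \<in> formal_sums K A m" "(c, w) \<in> set s"
  shows "c \<in> carrier K" "w \<in> tensor_words A m"
  using assms by (auto simp: formal_sums_def)

lemma tensor_words_update:
  "w \<in> tensor_words A m \<Longrightarrow> a \<in> carrier A \<Longrightarrow> w[q := a] \<in> tensor_words A m"
  by (auto simp: tensor_words_def dest: set_update_subset_insert[THEN subsetD])

lemma tensor_words_nth: "w \<in> tensor_words A m \<Longrightarrow> q < m \<Longrightarrow> w ! q \<in> carrier A"
  by (auto simp: tensor_words_def)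

lemma words_length: "w \<in> tensor_words A m \<Longrightarrow> length w = m"
  by (simp add: tensor_words_def)

lemma tensor_eq_carrier:
  assumes "tensor_eq K A m s t"
  shows "s \<in> formal_sums K A m" "t \<in> formal_sums K A m"
  using assms by (induction) (auto simp: tensor_words_def)

text \<open>Splitting the word at \<open>q\<close> gives the rule \<open>letter_add\<close>. With an
  update in place of the split, a map on words can be tested for multilinearity by how it commutes
  with changing one letter.\<close>

lemma letter_add_update:
  assumes "c \<in> carrier K" "a \<in> carrier A" "b \<in> carrier A" "w \<in> tensor_words A m" "q < m"
  shows "tensor_eq K A m [(c, w[q := a \<oplus>\<^bsub>A\<^esub> b])] [(c, w[q := a]), (c, w[q := b])]"
  using tensor_eq.letter_add[of c K a A b "take q w" "drop (Suc q) w" m] assms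
  by (auto simp: tensor_words_def upd_conv_take_nth_drop in_listsI
        dest: in_set_takeD in_set_dropD)

lemma letter_smult_update:
  assumes "c \<in> carrier K" "d \<in> carrier K" "a \<in> carrier A" "w \<in> tensor_words A m" "q < m"
  shows "tensor_eq K A m [(c, w[q := d \<odot>\<^bsub>A\<^esub> a])] [(c \<otimes>\<^bsub>K\<^esub> d, w[q := a])]"
  using tensor_eq.letter_smult[of c K d a A "take q w" "drop (Suc q) w" m] assms
  by (auto simp: tensor_words_def upd_conv_take_nth_drop in_listsI
        dest: in_set_takeD in_set_dropD)

text \<open>This is the universal property of the tensor power in terms of formal sums. A map
  defined term by term respects concatenation and commutation by itself, so only the four
  multilinearity relations on single terms are left to check.\<close>

lemma tensor_eq_concat_map:
  assumes eq: "tensor_eq K A m s t"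
    and closed: "\<And>c w. c \<in> carrier K \<Longrightarrow> w \<in> tensor_words A m \<Longrightarrow> f (c, w) \<in> formal_sums K A n"
    and zero: "\<And>w. w \<in> tensor_words A m \<Longrightarrow> tensor_eq K A n (f (\<zero>\<^bsub>K\<^esub>, w)) []"
    and add: "\<And>c d w. c \<in> carrier K \<Longrightarrow> d \<in> carrier K \<Longrightarrow> w \<in> tensor_words A m \<Longrightarrow>
      tensor_eq K A n (f (c \<oplus>\<^bsub>K\<^esub> d, w)) (f (c, w) @ f (d, w))"
    and letter_add: "\<And>c a b w q. c \<in> carrier K \<Longrightarrow> a \<in> carrier A \<Longrightarrow> b \<in> carrier A \<Longrightarrow>
      w \<in> tensor_words A m \<Longrightarrow> q < m \<Longrightarrow>
      tensor_eq K A n (f (c, w[q := a \<oplus>\<^bsub>A\<^esub> b])) (f (c, w[q := a]) @ f (c, w[q := b]))"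
    and letter_smult: "\<And>c d a w q. c \<in> carrier K \<Longrightarrow> d \<in> carrier K \<Longrightarrow> a \<in> carrier A \<Longrightarrow>
      w \<in> tensor_words A m \<Longrightarrow> q < m \<Longrightarrow>
      tensor_eq K A n (f (c, w[q := d \<odot>\<^bsub>A\<^esub> a])) (f (c \<otimes>\<^bsub>K\<^esub> d, w[q := a]))"
  shows "tensor_eq K A n (concat (map f s)) (concat (map f t))"
proof -
  have closed': "concat (map f s) \<in> formal_sums K A n" if "s \<in> formal_sums K A m" for s
    using that closed by (induction s) auto
  from eq show ?thesis
  proof induction
    \<comment> \<open>With \<open>u @ a # v\<close> as the word and \<open>length u\<close> as the
      index, an update turns the split form of the relation into the form of the hypothesis;
      \<open>letter_smult\<close> is treated alike.\<close>
    case (letter_add c a b u v)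
    then show ?case
      using assms(5)[of c a b "u @ a # v" "length u"] by (auto simp: tensor_words_def)
  next
    case (letter_smult c d a u v)
    then show ?case
      using assms(6)[of c d a "u @ a # v" "length u"] by (auto simp: tensor_words_def)
  qed (auto simp: closed' zero add intro: tensor_eq.refl tensor_eq.sym tensor_eq.trans
        tensor_eq.append tensor_eq.comm)
qed

lemma tensor_eq_concat_cong:
  assumes "\<And>x. x \<in> set s \<Longrightarrow> tensor_eq K A n (f x) (g x)"
  shows "tensor_eq K A n (concat (map f s)) (concat (map g s))"
  using assms by (induction s) (auto intro: tensor_eq.refl tensor_eq.append)

lemma tensor_eq_concat_Nil:
  assumes "\<And>x. x \<in> set s \<Longrightarrow> tensor_eq K A n (f x) []"
  shows "tensor_eq K A n (concat (map f s)) []"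
proof -
  have "concat (map (\<lambda>_. []) s) = ([] :: ('k, 'b) formal_sum)"
    by (induction s) auto
  with tensor_eq_concat_cong[of s n f "\<lambda>_. []"] assms show ?thesis
    by metis
qed

text \<open>It serves maps whose value on one term is again a sum over a second formal sum:
  additivity of each summand gives additivity of the whole, up to a rearrangement.\<close>

lemma tensor_eq_concat_append:
  assumes "\<And>x. x \<in> set s \<Longrightarrow> tensor_eq K A n (f x) (g x @ h x)"
  shows "tensor_eq K A n (concat (map f s)) (concat (map g s) @ concat (map h s))"
  using assms
proof (induction s)
  case (Cons x s)
  let ?g = "concat (map g s)" and ?h = "concat (map h s)"
  have IH: "tensor_eq K A n (concat (map f s)) (?g @ ?h)" and x: "tensor_eq K A n (f x) (g x @ h x)"
    using Cons by auto
  have mem: "g x \<in> formal_sums K A n" "h x \<in> formal_sums K A n"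
      "?g \<in> formal_sums K A n" "?h \<in> formal_sums K A n"
    using tensor_eq_carrier(2)[OF IH] tensor_eq_carrier(2)[OF x] by auto
  \<comment> \<open>Splitting term by term interleaves the two sums; here \<open>h x\<close> is
    moved past the \<open>g\<close>-part of the tail.\<close>
  have "tensor_eq K A n (g x @ (h x @ ?g) @ ?h) (g x @ (?g @ h x) @ ?h)"
    using mem by (intro tensor_eq.append tensor_eq.comm tensor_eq.refl)
  with tensor_eq.append[OF x IH] show ?case
    by (auto intro: tensor_eq.trans)
qed (auto intro: tensor_eq.refl)

lemmas tensor_eq_map_cong = tensor_eq_concat_cong[of _ _ "\<lambda>x. [f x]" "\<lambda>x. [g x]" for f g,
    unfolded concat_map_singleton]
  and tensor_eq_map_Nil = tensor_eq_concat_Nil[of _ _ "\<lambda>x. [f x]" for f,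
    unfolded concat_map_singleton]
  and tensor_eq_map_append = tensor_eq_concat_append[of _ _ "\<lambda>x. [f x]" "\<lambda>x. [g x]" "\<lambda>x. [h x]" for f g h,
    unfolded concat_map_singleton]
  and tensor_eq_map = tensor_eq_concat_map[of _ _ _ "\<lambda>x. [f x]" for f,
    unfolded concat_map_singleton]

section \<open>Componentwise multiplication of formal sums\<close>

lemma map2_mult_update:
  assumes "length v = length w" "q < length v"
  shows "map2 (\<otimes>\<^bsub>A\<^esub>) (v[q := a]) w = (map2 (\<otimes>\<^bsub>A\<^esub>) v w)[q := a \<otimes>\<^bsub>A\<^esub> w ! q]"
    and "map2 (\<otimes>\<^bsub>A\<^esub>) v (w[q := a]) = (map2 (\<otimes>\<^bsub>A\<^esub>) v w)[q := v ! q \<otimes>\<^bsub>A\<^esub> a]"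
  using assms by (auto intro!: nth_equalityI simp: nth_list_update)

lemma map2_mult_words:
  assumes "v \<in> tensor_words A m" "w \<in> tensor_words A m"
  shows "map2 (\<otimes>\<^bsub>A\<^esub>) v w \<in> tensor_words A m"
  using assms by (auto simp: tensor_words_def in_set_zip)

lemma formal_mult_eq_concat:
  "formal_mult K A s t =
    concat (map (\<lambda>(c, v). map (\<lambda>(d, w). (c \<otimes>\<^bsub>K\<^esub> d, map2 (\<otimes>\<^bsub>A\<^esub>) v w)) t) s)"
  by (simp add: formal_mult_def)

text \<open>For a fixed term \<open>(d, v)\<close> on the right, changing the letter in place
  \<open>q\<close> of the left word changes the product only in place \<open>q\<close>, where the
  new letter is multiplied by \<open>v ! q\<close>. Distributivity and compatibility with scalars in
  the algebra then give multilinearity.\<close>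

lemma formal_mult_cong_left:
  assumes "tensor_eq K A m s s'" and t: "t \<in> formal_sums K A m"
  shows "tensor_eq K A m (formal_mult K A s t) (formal_mult K A s' t)"
  unfolding formal_mult_eq_concat
proof (rule tensor_eq_concat_map[OF assms(1)], goal_cases)
  case (1 c w)
  then show ?case
    using t by (fastforce simp: formal_sums_def intro: map2_mult_words)
next
  case (2 w)
  then show ?case
    unfolding split using formal_sums_memD[OF t]
    by (intro tensor_eq_map_Nil)
      (auto simp: map2_mult_words intro!: tensor_eq.coeff_zero)
next
  case (3 c d w)
  then show ?case
    unfolding split using formal_sums_memD[OF t]
    by (intro tensor_eq_map_append)
      (auto simp: map2_mult_words K.l_distr intro!: tensor_eq.coeff_add)
next
  case (4 c a b w q)
  show ?case
    unfolding split
  proof (intro tensor_eq_map_append, clarify, goal_cases)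
    case (1 d v)
    have v: "d \<in> carrier K" "v \<in> tensor_words A m" "v ! q \<in> carrier A"
      using formal_sums_memD[OF t 1] 4 by (auto intro: tensor_words_nth)
    have len: "length v = m" "length w = m" using v 4 by (auto simp: tensor_words_def)
    show ?case
      using letter_add_update[of "c \<otimes>\<^bsub>K\<^esub> d" "a \<otimes>\<^bsub>A\<^esub> v ! q" "b \<otimes>\<^bsub>A\<^esub> v ! q" "map2 (\<otimes>\<^bsub>A\<^esub>) w v" m q]
        v 4 len by (simp add: map2_mult_update map2_mult_words A.l_distr)
  qed
next
  case (5 c d a w q)
  show ?case
    unfolding split
  proof (intro tensor_eq_map_cong, clarify, goal_cases)
    case (1 e v)
    have v: "e \<in> carrier K" "v \<in> tensor_words A m" "v ! q \<in> carrier A"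
      using formal_sums_memD[OF t 1] 5 by (auto intro: tensor_words_nth)
    have len: "length v = m" "length w = m" using v 5 by (auto simp: tensor_words_def)
    \<comment> \<open>A scalar taken out of a letter arrives at the right end of the coefficient, so
      commutativity of the field has to move it past \<open>e\<close>.\<close>
    have "c \<otimes>\<^bsub>K\<^esub> d \<otimes>\<^bsub>K\<^esub> e = c \<otimes>\<^bsub>K\<^esub> e \<otimes>\<^bsub>K\<^esub> d"
      using v 5 by (simp add: K.m_ac)
    then show ?case
      using letter_smult_update[of "c \<otimes>\<^bsub>K\<^esub> e" d "a \<otimes>\<^bsub>A\<^esub> v ! q" "map2 (\<otimes>\<^bsub>A\<^esub>) w v" m q]
        v 5 len by (simp add: map2_mult_update map2_mult_words smult_mult_left)
  qed
qed

text \<open>The terms of \<open>s\<close> are fixed one at a time, and the relation is transported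
  through the map on \<open>t\<close> given by each of them. The scalars already stand in the right
  order, so associativity suffices where the left argument needed commutativity.\<close>

lemma formal_mult_cong_right:
  assumes s: "s \<in> formal_sums K A m" and "tensor_eq K A m t t'"
  shows "tensor_eq K A m (formal_mult K A s t) (formal_mult K A s t')"
  unfolding formal_mult_eq_concat
proof (intro tensor_eq_concat_cong, clarify)
  fix c v assume "(c, v) \<in> set s"
  then have v: "c \<in> carrier K" "v \<in> tensor_words A m" "length v = m"
    using formal_sums_memD[OF s] by (auto simp: tensor_words_def)
  show "tensor_eq K A m (map (\<lambda>(d, w). (c \<otimes>\<^bsub>K\<^esub> d, map2 (\<otimes>\<^bsub>A\<^esub>) v w)) t)
      (map (\<lambda>(d, w). (c \<otimes>\<^bsub>K\<^esub> d, map2 (\<otimes>\<^bsub>A\<^esub>) v w)) t')"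
  proof (rule tensor_eq_map[OF assms(2)], goal_cases)
    case (4 d a b w q)
    then have vq: "v ! q \<in> carrier A" "length w = m"
      using v by (auto simp: tensor_words_def)
    with 4 v show ?case
      using letter_add_update[of "c \<otimes>\<^bsub>K\<^esub> d" "v ! q \<otimes>\<^bsub>A\<^esub> a" "v ! q \<otimes>\<^bsub>A\<^esub> b" "map2 (\<otimes>\<^bsub>A\<^esub>) v w" m q]
      by (simp add: map2_mult_update map2_mult_words A.r_distr)
  next
    case (5 d e a w q)
    then have vq: "v ! q \<in> carrier A" "length w = m"
      using v by (auto simp: tensor_words_def)
    with 5 v show ?case
      using letter_smult_update[of "c \<otimes>\<^bsub>K\<^esub> d" e "v ! q \<otimes>\<^bsub>A\<^esub> a" "map2 (\<otimes>\<^bsub>A\<^esub>) v w" m q]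
      by (simp add: map2_mult_update map2_mult_words smult_mult_right K.m_assoc)
  qed (use v in \<open>auto simp: map2_mult_words K.r_distr intro: tensor_eq.coeff_zero tensor_eq.coeff_add\<close>)
qed

lemma formal_mult_cong:
  assumes "tensor_eq K A m s s'" "tensor_eq K A m t t'"
  shows "tensor_eq K A m (formal_mult K A s t) (formal_mult K A s' t')"
  using formal_mult_cong_left[OF assms(1)] formal_mult_cong_right[OF _ assms(2)] assms
  by (blast intro: tensor_eq.trans dest: tensor_eq_carrier)

section \<open>Classes of formal sums and operations on them\<close>

lemma mem_tensor_class [simp]: "t \<in> tensor_class K A m s \<longleftrightarrow> tensor_eq K A m s t"
  by (simp add: tensor_class_def tensor_rel_def)

lemma tensor_class_cong: "tensor_eq K A m s t \<Longrightarrow> tensor_class K A m s = tensor_class K A m t"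
  by (rule Set.set_eqI) (simp, blast intro: tensor_eq.trans tensor_eq.sym)

lemma tensor_class_eqD:
  "tensor_class K A m s = tensor_class K A m t \<Longrightarrow> t \<in> formal_sums K A m \<Longrightarrow> tensor_eq K A m s t"
  by (metis mem_tensor_class tensor_eq.refl)

lemma tensor_power_carrier:
  "carrier (tensor_power K A m) = tensor_class K A m ` formal_sums K A m"
  by (auto simp: tensor_power_def quotient_def tensor_class_def)

lemma tensor_power_same_class:
  assumes "X \<in> carrier (tensor_power K A m)" "s \<in> X"
  shows "X = tensor_class K A m s"
proof -
  obtain t where "X = tensor_class K A m t"
    using assms(1) by (auto simp: tensor_power_carrier)
  then show ?thesis
    using assms(2) by (simp add: tensor_class_cong)
qed

text \<open>The lift is a union over all representatives. Compatibility of \<open>F\<close> makes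
  all members of the union equal, and the class is nonempty because it contains \<open>s\<close>, so
  the union collapses to a single class.\<close>

lemma tensor_lift_class:
  assumes "s \<in> formal_sums K A m"
    and "\<And>t. tensor_eq K A m s t \<Longrightarrow> tensor_eq K A n (F s) (F t)"
  shows "tensor_lift K A n F (tensor_class K A m s) = tensor_class K A n (F s)"
proof -
  have "tensor_class K A m s \<noteq> {}"
    using tensor_eq.refl[OF assms(1)] by (metis empty_iff mem_tensor_class)
  then show ?thesis
    unfolding tensor_lift_def
    by (rule SUP_eq_const) (metis assms(2) mem_tensor_class tensor_class_cong)
qed

lemma tensor_class_UN2:
  assumes "s \<in> formal_sums K A m" "t \<in> formal_sums K A m"
    and "\<And>s' t'. tensor_eq K A m s s' \<Longrightarrow> tensor_eq K A m t t' \<Longrightarrow> tensor_eq K A m (F s t) (F s' t')"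
  shows "(\<Union>s'\<in>tensor_class K A m s. \<Union>t'\<in>tensor_class K A m t. tensor_class K A m (F s' t')) =
    tensor_class K A m (F s t)"
proof -
  have "tensor_class K A m s \<noteq> {}" "tensor_class K A m t \<noteq> {}"
    using assms(1,2)[THEN tensor_eq.refl] by (metis empty_iff mem_tensor_class)+
  then show ?thesis
    by (intro SUP_eq_const) (metis assms(3) mem_tensor_class tensor_class_cong)+
qed

lemma tensor_power_add:
  assumes "s \<in> formal_sums K A m" "t \<in> formal_sums K A m"
  shows "tensor_class K A m s \<oplus>\<^bsub>tensor_power K A m\<^esub> tensor_class K A m t = tensor_class K A m (s @ t)"
  using tensor_class_UN2[OF assms, of "(@)"] by (simp add: tensor_power_def tensor_eq.append)

lemma tensor_power_mult:
  assumes "s \<in> formal_sums K A m" "t \<in> formal_sums K A m"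
  shows "tensor_class K A m s \<otimes>\<^bsub>tensor_power K A m\<^esub> tensor_class K A m t =
    tensor_class K A m (formal_mult K A s t)"
  using tensor_class_UN2[OF assms, of "formal_mult K A"]
  by (simp add: tensor_power_def formal_mult_cong)

section \<open>Leg embeddings on words\<close>

definition leg_word :: "nat \<Rightarrow> nat \<Rightarrow> (nat \<Rightarrow> nat) \<Rightarrow> 'b list \<Rightarrow> 'b list"
  where "leg_word m n f w = map (\<lambda>p. if p \<in> f ` {1..m} then w ! (inv_into {1..m} f p - 1)
    else \<one>\<^bsub>A\<^esub>) [1..<Suc n]"

lemma length_leg_word [simp]: "length (leg_word m n f w) = n"
  by (simp add: leg_word_def)

text \<open>Factors are numbered from 1 and list entries from 0, whence the two shifts. Injectivity
  of \<open>f\<close> makes \<open>inv_into\<close> return exactly \<open>s\<close>.\<close>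

lemma leg_word_nth:
  assumes "inj_on f {1..m}" "f ` {1..m} \<subseteq> {1..n}" "s \<in> {1..m}"
  shows "leg_word m n f w ! (f s - 1) = w ! (s - 1)"
proof -
  have "f s \<in> {1..n}" using assms by blast
  then show ?thesis
    using assms by (auto simp: leg_word_def nth_map simp del: upt_Suc)
qed

lemma leg_word_nth_outside:
  assumes "p \<in> {1..n}" "p \<notin> f ` {1..m}"
  shows "leg_word m n f w ! (p - 1) = \<one>\<^bsub>A\<^esub>"
  using assms by (auto simp: leg_word_def nth_map simp del: upt_Suc)

lemma leg_word_closed:
  assumes "inj_on f {1..m}" "w \<in> tensor_words A m"
  shows "leg_word m n f w \<in> tensor_words A n"
proof -
  have "w ! (inv_into {1..m} f p - 1) \<in> carrier A" if "p \<in> f ` {1..m}" for p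
    using inv_into_into[OF that] assms(2) by (intro tensor_words_nth) auto
  then show ?thesis
    by (auto simp: leg_word_def tensor_words_def simp del: upt_Suc)
qed

text \<open>Since \<open>f\<close> is injective, exactly one position of the longer word reads the
  letter \<open>q\<close>; the positions outside the image hold 1 in either case. This is what makes
  the leg embedding linear in each letter.\<close>

lemma leg_word_update:
  assumes f: "inj_on f {1..m}" "f ` {1..m} \<subseteq> {1..n}" and w: "length w = m" "q < m"
  shows "leg_word m n f (w[q := a]) = (leg_word m n f w)[f (Suc q) - 1 := a]"
proof (intro nth_equalityI)
  fix r assume "r < length (leg_word m n f (w[q := a]))"
  then have r: "r < n" "Suc r \<in> {1..n}" by auto
  have "Suc q \<in> {1..m}" using w by simp
  with f(2) have q: "Suc q \<in> {1..m}" "f (Suc q) \<in> {1..n}" by blast+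
  show "leg_word m n f (w[q := a]) ! r = (leg_word m n f w)[f (Suc q) - 1 := a] ! r"
  proof (cases "Suc r \<in> f ` {1..m}")
    case True
    then obtain s where s: "s \<in> {1..m}" "Suc r = f s" by auto
    have eq: "f s = f (Suc q) \<longleftrightarrow> s = Suc q" using f(1) s q by (meson inj_onD)
    have *: "leg_word m n f v ! r = v ! (s - 1)" for v
      using leg_word_nth[OF f s(1), of v] by (simp flip: s(2))
    have "f (Suc q) - 1 = r \<longleftrightarrow> s = Suc q" "s - 1 = q \<longleftrightarrow> s = Suc q"
      using eq s q(2) by auto
    then show ?thesis
      using r w by (cases "s = Suc q") (simp_all add: * nth_list_update)
  next
    case False
    then have *: "leg_word m n f v ! r = \<one>\<^bsub>A\<^esub>" for v
      using leg_word_nth_outside[OF r(2) False, of v] by simp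
    have "f (Suc q) - 1 \<noteq> r" using False q by force
    then show ?thesis by (simp add: *)
  qed
qed simp

lemma tensor_leg_class:
  assumes f: "inj_on f {1..m}" "f ` {1..m} \<subseteq> {1..n}" and s: "s \<in> formal_sums K A m"
  shows "tensor_leg K A m n f (tensor_class K A m s) =
    tensor_class K A n (map (\<lambda>(c, w). (c, leg_word m n f w)) s)"
proof -
  have "tensor_eq K A n (map (\<lambda>(c, w). (c, leg_word m n f w)) s) (map (\<lambda>(c, w). (c, leg_word m n f w)) t)"
    if "tensor_eq K A m s t" for t
  proof (rule tensor_eq_map[OF that], goal_cases)
    case (4 c a b w q)
    \<comment> \<open>The list index \<open>q\<close> belongs to the factor \<open>Suc q\<close>,
      which lands in the factor \<open>f (Suc q)\<close>, that is at the list index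
      \<open>f (Suc q) - 1\<close>.\<close>
    from \<open>q < m\<close> have "Suc q \<in> {1..m}" by simp
    with f(2) have "f (Suc q) \<in> {1..n}" by blast
    then have "f (Suc q) - 1 < n" by auto
    with 4 show ?case
      using letter_add_update[of c a b "leg_word m n f w" n "f (Suc q) - 1"]
      by (simp add: words_length leg_word_closed[OF f(1)] leg_word_update[OF f])
  next
    case (5 c d a w q)
    from \<open>q < m\<close> have "Suc q \<in> {1..m}" by simp
    with f(2) have "f (Suc q) \<in> {1..n}" by blast
    then have "f (Suc q) - 1 < n" by auto
    with 5 show ?case
      using letter_smult_update[of c d a "leg_word m n f w" n "f (Suc q) - 1"]
      by (simp add: words_length leg_word_closed[OF f(1)] leg_word_update[OF f])
  qed (auto simp: leg_word_closed[OF f(1)] intro: tensor_eq.coeff_zero tensor_eq.coeff_add)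
  then have "tensor_lift K A n (map (\<lambda>(c, w). (c, leg_word m n f w))) (tensor_class K A m s) =
    tensor_class K A n (map (\<lambda>(c, w). (c, leg_word m n f w)) s)"
    by (rule tensor_lift_class[OF s])
  then show ?thesis
    by (simp add: tensor_leg_def leg_word_def)
qed

text \<open>These words describe the \<open>p\<close>-th copy of \<open>B\<close> inside the
  \<open>m\<close>-th tensor power. All later comparisons of maps are made on such elements.\<close>

definition letter_at :: "nat \<Rightarrow> nat \<Rightarrow> 'b \<Rightarrow> 'b list"
  where "letter_at m p b = (replicate m \<one>\<^bsub>A\<^esub>)[p - 1 := b]"

lemma letter_at_closed: "b \<in> carrier A \<Longrightarrow> letter_at m p b \<in> tensor_words A m"
  unfolding letter_at_def by (rule tensor_words_update) (auto simp: tensor_words_def)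

text \<open>A leg embedding sends the word of ones to the word of ones, and the single exceptional
  letter follows \<open>f\<close>.\<close>

lemma leg_word_letter_at:
  assumes f: "inj_on f {1..m}" "f ` {1..m} \<subseteq> {1..n}" and p: "p \<in> {1..m}"
  shows "leg_word m n f (letter_at m p b) = letter_at n (f p) b"
proof -
  have "leg_word m n f (replicate m \<one>\<^bsub>A\<^esub>) = replicate n \<one>\<^bsub>A\<^esub>"
  proof (intro nth_equalityI)
    fix r assume "r < length (leg_word m n f (replicate m \<one>\<^bsub>A\<^esub>))"
    then have r: "r < n" "Suc r \<in> {1..n}" by auto
    show "leg_word m n f (replicate m \<one>\<^bsub>A\<^esub>) ! r = replicate n \<one>\<^bsub>A\<^esub> ! r"
    proof (cases "Suc r \<in> f ` {1..m}")
      case True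
      then obtain s where s: "s \<in> {1..m}" "Suc r = f s" by auto
      then have "s - 1 < m" by auto
      then show ?thesis
        using leg_word_nth[OF f s(1), of "replicate m \<one>\<^bsub>A\<^esub>"] r s(1) by (simp flip: s(2))
    qed (use leg_word_nth_outside[OF r(2)] r in simp)
  qed simp
  then show ?thesis
    using leg_word_update[OF f, of "replicate m \<one>\<^bsub>A\<^esub>" "p - 1" b] p
    by (cases p) (simp_all add: letter_at_def)
qed

end

section \<open>The comultiplication on a tensor factor\<close>

sublocale bialgebra \<subseteq> tensor_powers K B ..

context bialgebra
begin

text \<open>This is the choice that occurs inside \<open>tensor_comult\<close>, named so that the
  latter can be computed on formal sums.\<close>

definition comult_rep :: "'b \<Rightarrow> ('k, 'b) formal_sum"
  where "comult_rep b = (SOME t. t \<in> \<Delta> b)"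

text \<open>The value \<open>\<Delta> b\<close> is the class of some formal sum and contains that
  sum, so the choice really picks a member, and any member determines the class.\<close>

lemma comult_rep:
  assumes "b \<in> carrier B"
  shows "comult_rep b \<in> formal_sums K B 2" and "\<Delta> b = tensor_class K B 2 (comult_rep b)"
proof -
  have \<Delta>: "\<Delta> b \<in> carrier (tensor_power K B 2)"
    using comult_hom assms by (auto simp: algebra_hom_def ring_hom_def)
  then obtain s where s: "s \<in> formal_sums K B 2" "\<Delta> b = tensor_class K B 2 s"
    by (auto simp: tensor_power_carrier)
  then have "s \<in> \<Delta> b"
    by (simp add: tensor_eq.refl)
  then have rep: "comult_rep b \<in> \<Delta> b"
    unfolding comult_rep_def by (rule someI)
  then have "tensor_eq K B 2 s (comult_rep b)"
    by (simp add: s)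
  then show "comult_rep b \<in> formal_sums K B 2"
    by (rule tensor_eq_carrier)
  show "\<Delta> b = tensor_class K B 2 (comult_rep b)"
    using \<Delta> rep by (rule tensor_power_same_class)
qed

text \<open>The comultiplication is additive on classes only, so the chosen representatives add up
  merely modulo \<open>tensor_eq\<close>. The same holds for scalars and for the unit below.\<close>

lemma comult_rep_add:
  assumes "a \<in> carrier B" "b \<in> carrier B"
  shows "tensor_eq K B 2 (comult_rep (a \<oplus>\<^bsub>B\<^esub> b)) (comult_rep a @ comult_rep b)"
proof -
  have "\<Delta> (a \<oplus>\<^bsub>B\<^esub> b) = \<Delta> a \<oplus>\<^bsub>tensor_power K B 2\<^esub> \<Delta> b"
    using comult_hom assms by (auto simp: algebra_hom_def ring_hom_def)
  then have "tensor_class K B 2 (comult_rep (a \<oplus>\<^bsub>B\<^esub> b)) = tensor_class K B 2 (comult_rep a @ comult_rep b)"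
    using comult_rep assms by (simp add: tensor_power_add)
  then show ?thesis
    using comult_rep assms by (intro tensor_class_eqD) auto
qed

lemma comult_rep_smult:
  assumes "d \<in> carrier K" "a \<in> carrier B"
  shows "tensor_eq K B 2 (comult_rep (d \<odot>\<^bsub>B\<^esub> a)) (map (\<lambda>(e, w). (d \<otimes>\<^bsub>K\<^esub> e, w)) (comult_rep a))"
    (is "tensor_eq K B 2 _ ?t")
proof -
  have t: "?t \<in> formal_sums K B 2"
    using comult_rep(1)[OF assms(2)] assms(1) by (fastforce simp: formal_sums_def)
  have "\<Delta> (d \<odot>\<^bsub>B\<^esub> a) = d \<odot>\<^bsub>tensor_power K B 2\<^esub> \<Delta> a"
    using comult_hom assms by (auto simp: algebra_hom_def)
  \<comment> \<open>Scalar multiplication of a class is a union over its representatives. The scaled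
    representative lies in the member of this union indexed by \<open>comult_rep a\<close>, and
    membership is all that is needed.\<close>
  moreover have "comult_rep a \<in> \<Delta> a"
    using comult_rep[OF assms(2)] by (auto intro: tensor_eq.refl)
  ultimately have "?t \<in> \<Delta> (d \<odot>\<^bsub>B\<^esub> a)"
    using t by (auto simp: tensor_power_def intro!: tensor_eq.refl bexI[of _ "comult_rep a"])
  then show ?thesis
    using comult_rep(2)[of "d \<odot>\<^bsub>B\<^esub> a"] assms by simp
qed

lemma comult_rep_one: "tensor_eq K B 2 (comult_rep \<one>\<^bsub>B\<^esub>) [(\<one>\<^bsub>K\<^esub>, [\<one>\<^bsub>B\<^esub>, \<one>\<^bsub>B\<^esub>])]"
proof -
  have "\<Delta> \<one>\<^bsub>B\<^esub> = \<one>\<^bsub>tensor_power K B 2\<^esub>"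
    using comult_hom by (auto simp: algebra_hom_def ring_hom_def)
  then have "tensor_class K B 2 (comult_rep \<one>\<^bsub>B\<^esub>) = tensor_class K B 2 [(\<one>\<^bsub>K\<^esub>, [\<one>\<^bsub>B\<^esub>, \<one>\<^bsub>B\<^esub>])]"
    by (simp add: tensor_power_def replicate_Suc[of 1, unfolded Suc_1]
        flip: comult_rep(2)[OF A.one_closed])
  then show ?thesis
    by (rule tensor_class_eqD) (simp add: tensor_words_def)
qed

section \<open>Comultiplying one factor of a formal sum\<close>

definition pad :: "'k \<Rightarrow> 'b list \<Rightarrow> 'b list \<Rightarrow> ('k, 'b) formal_sum \<Rightarrow> ('k, 'b) formal_sum"
  where "pad c l r t = map (\<lambda>(d, v). (c \<otimes>\<^bsub>K\<^esub> d, l @ v @ r)) t"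

lemma pad_word:
  assumes "v \<in> tensor_words B m" "l \<in> lists (carrier B)" "r \<in> lists (carrier B)"
    "length l + m + length r = n"
  shows "l @ v @ r \<in> tensor_words B n"
  using assms by (auto simp: tensor_words_def)

lemma pad_closed:
  assumes "t \<in> formal_sums K B m" "c \<in> carrier K" "l \<in> lists (carrier B)" "r \<in> lists (carrier B)"
    "length l + m + length r = n"
  shows "pad c l r t \<in> formal_sums K B n"
  using assms by (fastforce simp: formal_sums_def pad_def intro: pad_word)

text \<open>The map \<open>pad c l r\<close> is
  \<open>t \<mapsto> c (l \<otimes> t \<otimes> r)\<close>. The letter \<open>q\<close> of a word of
  \<open>t\<close> ends up at the index \<open>length l + q\<close>, so multilinearity in the inner
  word is inherited from the outer one.\<close>

lemma pad_cong:
  assumes "tensor_eq K B m t t'" "c \<in> carrier K" "l \<in> lists (carrier B)" "r \<in> lists (carrier B)"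
    "length l + m + length r = n"
  shows "tensor_eq K B n (pad c l r t) (pad c l r t')"
  unfolding pad_def
proof (rule tensor_eq_map[OF assms(1)], goal_cases)
  have word: "l @ w @ r \<in> tensor_words B n" if "w \<in> tensor_words B m" for w
    using pad_word that assms by blast
  {
  case (4 d a b w q)
  have up: "l @ w[q := x] @ r = (l @ w @ r)[length l + q := x]" for x
    using 4 by (simp add: list_update_append tensor_words_def)
  from 4 show ?case
    unfolding up split using assms
    letter_add_update[of "c \<otimes>\<^bsub>K\<^esub> d" a b "l @ w @ r" n "length l + q"]
    by (simp add: word)
next
  case (5 d e a w q)
  have up: "l @ w[q := x] @ r = (l @ w @ r)[length l + q := x]" for x
    using 5 by (simp add: list_update_append tensor_words_def)
  from 5 show ?case
    unfolding up split using assms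
    letter_smult_update[of "c \<otimes>\<^bsub>K\<^esub> d" e a "l @ w @ r" n "length l + q"]
    by (simp add: word K.m_assoc)
next
  case (1 d w)
  then show ?case using assms by (simp add: word)
next
  case (2 w)
  then show ?case using assms by (simp add: word tensor_eq.coeff_zero)
next
  case (3 d e w)
  then show ?case using assms by (simp add: word K.r_distr tensor_eq.coeff_add)
  }
qed

definition formal_comult :: "nat \<Rightarrow> ('k, 'b) formal_sum \<Rightarrow> ('k, 'b) formal_sum"
  where "formal_comult i s =
    concat (map (\<lambda>(c, w). pad c (take (i - 1) w) (drop i w) (comult_rep (w ! (i - 1)))) s)"

text \<open>If the changed letter is the one being comultiplied, linearity of
  \<open>\<Delta>\<close> and \<open>pad_cong\<close> apply. Otherwise the chosen representative
  stays the same and the change is an update of one of the surrounding letters.\<close>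

lemma formal_comult_cong:
  assumes st: "tensor_eq K B m s t" and i: "i \<in> {1..m}"
  shows "tensor_eq K B (m + 1) (formal_comult i s) (formal_comult i t)"
  unfolding formal_comult_def
proof (rule tensor_eq_concat_map[OF st], unfold split, goal_cases)
  let ?l = "\<lambda>w :: 'b list. take (i - 1) w" and ?r = "\<lambda>w :: 'b list. drop i w"
  have lr: "?l w \<in> lists (carrier B)" "?r w \<in> lists (carrier B)"
    "length (?l w) + 2 + length (?r w) = m + 1" "w ! (i - 1) \<in> carrier B" "length w = m"
    if "w \<in> tensor_words B m" for w
    using that i by (auto simp: tensor_words_def dest: in_set_takeD in_set_dropD)
  have word: "?l w @ v @ ?r w \<in> tensor_words B (m + 1)"
    if "w \<in> tensor_words B m" "v \<in> tensor_words B 2" for v w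
    using that lr by (intro pad_word) auto
  have rep: "d \<in> carrier K" "v \<in> tensor_words B 2" "length v = 2"
    if "w \<in> tensor_words B m" "(d, v) \<in> set (comult_rep (w ! (i - 1)))" for d v w
    using formal_sums_memD[OF comult_rep(1)[OF lr(4)[OF that(1)]] that(2)]
    by (auto simp: tensor_words_def)
  \<comment> \<open>One letter is replaced by two, so every letter to the right of it moves on by
    one place.\<close>
  let ?q = "\<lambda>q. if q < i - 1 then q else q + 1"
  have up: "?l (w[q := x]) @ v @ ?r (w[q := x]) = (?l w @ v @ ?r w)[?q q := x]"
    if "length w = m" "length v = 2" "q \<noteq> i - 1" "q < m" for w v x q
  proof (cases "q < i - 1")
    case True
    then show ?thesis
      using that i by (simp add: list_update_append take_update_swap)
  next
    case False
    with that i have "q + 1 - (i - 1) \<ge> 2" "q + 1 - (i - 1) - 2 = q - i" by auto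
    with False show ?thesis
      using that i by (simp add: list_update_append drop_update_swap)
  qed
  {
    case (1 c w)
    then show ?case using lr comult_rep by (intro pad_closed[where m = 2]) auto
  next
    case (2 w)
    show ?case
      unfolding pad_def using rep[OF 2] word[OF 2]
      by (intro tensor_eq_map_Nil) (auto intro!: tensor_eq.coeff_zero)
  next
    case (3 c d w)
    then show ?case
      unfolding pad_def using rep[OF 3(3)] word[OF 3(3)]
      by (intro tensor_eq_map_append) (auto simp: K.l_distr intro!: tensor_eq.coeff_add)
  next
    case (4 c a b w q)
    show ?case
    proof (cases "q = i - 1")
      case True
      have "tensor_eq K B (m + 1) (pad c (?l w) (?r w) (comult_rep (a \<oplus>\<^bsub>B\<^esub> b)))
          (pad c (?l w) (?r w) (comult_rep a @ comult_rep b))"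
        using 4 lr by (intro pad_cong[where m = 2] comult_rep_add) auto
      with True show ?thesis using 4 lr(5)[OF 4(4)] i by (simp add: pad_def)
    next
      case False
      then have nth: "w[q := x] ! (i - 1) = w ! (i - 1)" for x by simp
      show ?thesis unfolding pad_def nth
      proof (intro tensor_eq_map_append, clarify, goal_cases)
        case (1 d v)
        note v = rep[OF 4(4) 1]
        have "?q q < m + 1" using 4 by simp
        then show ?case
          using letter_add_update[of "c \<otimes>\<^bsub>K\<^esub> d" a b "?l w @ v @ ?r w" "m + 1" "?q q"] 4 v False
            word[OF 4(4) v(2)]
          by (simp add: up[OF lr(5)[OF 4(4)] v(3) False 4(5)] del: One_nat_def)
      qed
    qed
  next
    case (5 c d a w q)
    show ?case
    proof (cases "q = i - 1")
      case True
      have a: "\<And>e v. (e, v) \<in> set (comult_rep a) \<Longrightarrow> e \<in> carrier K"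
        using formal_sums_memD comult_rep(1) 5(3) by blast
      have "tensor_eq K B (m + 1) (pad c (?l w) (?r w) (comult_rep (d \<odot>\<^bsub>B\<^esub> a)))
          (pad c (?l w) (?r w) (map (\<lambda>(e, w). (d \<otimes>\<^bsub>K\<^esub> e, w)) (comult_rep a)))"
        using 5 lr by (intro pad_cong[where m = 2] comult_rep_smult) auto
      \<comment> \<open>The scalar is carried over from the inner coefficients to the outer one by
        associativity.\<close>
      also have "pad c (?l w) (?r w) (map (\<lambda>(e, w). (d \<otimes>\<^bsub>K\<^esub> e, w)) (comult_rep a)) =
          pad (c \<otimes>\<^bsub>K\<^esub> d) (?l w) (?r w) (comult_rep a)"
        using 5 a by (auto simp: pad_def K.m_assoc)
      finally show ?thesis using True 5 lr(5)[OF 5(4)] i by simp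
    next
      case False
      then have nth: "w[q := x] ! (i - 1) = w ! (i - 1)" for x by simp
      show ?thesis unfolding pad_def nth
      proof (intro tensor_eq_map_cong, clarify, goal_cases)
        case (1 e v)
        note v = rep[OF 5(4) 1]
        have "?q q < m + 1" using 5 by simp
        moreover have "c \<otimes>\<^bsub>K\<^esub> d \<otimes>\<^bsub>K\<^esub> e = c \<otimes>\<^bsub>K\<^esub> e \<otimes>\<^bsub>K\<^esub> d"
          using v 5 by (simp add: K.m_ac)
        ultimately show ?case
          using letter_smult_update[of "c \<otimes>\<^bsub>K\<^esub> e" d a "?l w @ v @ ?r w" "m + 1" "?q q"] 5 v False
            word[OF 5(4) v(2)]
          by (simp add: up[OF lr(5)[OF 5(4)] v(3) False 5(5)] del: One_nat_def)
      qed
    qed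
  }
qed

lemma tensor_comult_class:
  assumes i: "i \<in> {1..m}" and s: "s \<in> formal_sums K B m"
  shows "tensor_comult K B \<Delta> m i (tensor_class K B m s) = tensor_class K B (m + 1) (formal_comult i s)"
proof -
  have "tensor_comult K B \<Delta> m i = tensor_lift K B (m + 1) (formal_comult i)"
    by (simp add: tensor_comult_def formal_comult_def[abs_def] pad_def comult_rep_def)
  then show ?thesis
    using tensor_lift_class[OF s, of "m + 1" "formal_comult i"] formal_comult_cong i by simp
qed

end

section \<open>The Yang-Baxter equation\<close>

context completed_tensor_powers
begin

section \<open>The completions and the generators of the tensor square\<close>

lemma T_ring: "ring (T m)"
proof -
  interpret T: assoc_algebra K "T m" by (rule completion_algebra)
  show ?thesis by (rule T.A.ring_axioms)
qed

lemma inclusion_ring_hom: "\<iota> m \<in> ring_hom (tensor_power K B m) (T m)"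
  using inclusion_hom by (auto simp: algebra_hom_def)

lemma structural_ring_hom:
  assumes "structural leg comult counit m n \<phi>"
  shows "\<phi> \<in> ring_hom (T m) (T n)"
  using assms
proof induction
  case (comp l m \<phi> n \<psi>)
  then show ?case by (intro ring_hom_trans)
qed (use leg_hom comult_hom' counit_hom' in \<open>auto simp: algebra_hom_def ring_hom_def\<close>)

definition gen :: "nat \<Rightarrow> nat \<Rightarrow> 'b \<Rightarrow> 'a"
  where "gen m p b = \<iota> m (tensor_class K B m [(\<one>\<^bsub>K\<^esub>, letter_at m p b)])"

lemma gen_class_closed:
  "b \<in> carrier B \<Longrightarrow> tensor_class K B m [(\<one>\<^bsub>K\<^esub>, letter_at m p b)] \<in> carrier (tensor_power K B m)"
  by (simp add: tensor_power_carrier letter_at_closed)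

lemma gen_closed: "b \<in> carrier B \<Longrightarrow> gen m p b \<in> carrier (T m)"
  unfolding gen_def by (intro ring_hom_closed[OF inclusion_ring_hom] gen_class_closed)

lemma letter_at_simps:
  "letter_at 2 1 b = [b, \<one>\<^bsub>B\<^esub>]" "letter_at 2 2 b = [\<one>\<^bsub>B\<^esub>, b]"
  "letter_at 3 1 b = [b, \<one>\<^bsub>B\<^esub>, \<one>\<^bsub>B\<^esub>]" "letter_at 3 3 b = [\<one>\<^bsub>B\<^esub>, \<one>\<^bsub>B\<^esub>, b]"
  by (simp_all add: letter_at_def numeral_2_eq_2 numeral_3_eq_3)

text \<open>The coefficient is absorbed into the first letter. Pure tensors thereby become products
  of generators, and ring homomorphisms can be compared on them without scalars.\<close>

lemma inclusion_pure_tensor: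
  assumes "c \<in> carrier K" "a \<in> carrier B" "b \<in> carrier B"
  shows "\<iota> 2 (tensor_class K B 2 [(c, [a, b])]) = gen 2 1 (c \<odot>\<^bsub>B\<^esub> a) \<otimes>\<^bsub>T 2\<^esub> gen 2 2 b"
proof -
  have "tensor_eq K B 2 [(\<one>\<^bsub>K\<^esub>, [c \<odot>\<^bsub>B\<^esub> a, b])] [(c, [a, b])]"
    using tensor_eq.letter_smult[of "\<one>\<^bsub>K\<^esub>" K c a B "[]" "[b]" 2] assms by simp
  then have "tensor_class K B 2 [(c, [a, b])] = tensor_class K B 2 [(\<one>\<^bsub>K\<^esub>, [c \<odot>\<^bsub>B\<^esub> a, b])]"
    by (rule tensor_class_cong[symmetric])
  also have "\<dots> = tensor_class K B 2 [(\<one>\<^bsub>K\<^esub>, letter_at 2 1 (c \<odot>\<^bsub>B\<^esub> a))]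
      \<otimes>\<^bsub>tensor_power K B 2\<^esub> tensor_class K B 2 [(\<one>\<^bsub>K\<^esub>, letter_at 2 2 b)]"
    using assms by (subst tensor_power_mult)
      (simp_all add: formal_mult_def letter_at_simps tensor_words_def del: One_nat_def)
  finally show ?thesis
    unfolding gen_def using assms
    by (simp add: ring_hom_mult[OF inclusion_ring_hom] gen_class_closed)
qed

text \<open>The empty sum satisfies \<open>z + z = z\<close>, and its image can be cancelled in the
  ring \<open>T m\<close>; this avoids proving ring axioms for the tensor power.\<close>

lemma inclusion_zero: "\<iota> m (tensor_class K B m []) = \<zero>\<^bsub>T m\<^esub>"
proof -
  interpret T: ring "T m" by (rule T_ring)
  let ?z = "tensor_class K B m []"
  have z: "?z \<in> carrier (tensor_power K B m)" by (simp add: tensor_power_carrier)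
  have "\<iota> m (?z \<oplus>\<^bsub>tensor_power K B m\<^esub> ?z) = \<iota> m ?z \<oplus>\<^bsub>T m\<^esub> \<iota> m ?z"
    using z by (rule ring_hom_add[OF inclusion_ring_hom z])
  then have "\<iota> m ?z = \<iota> m ?z \<oplus>\<^bsub>T m\<^esub> \<iota> m ?z"
    by (simp add: tensor_power_add)
  then show ?thesis
    using ring_hom_closed[OF inclusion_ring_hom z] by (metis T.add.r_cancel_one')
qed

text \<open>The elements \<open>x\<close> with \<open>u (\<phi> x) = (\<psi> x) u\<close> form a subring, and the image of \<open>B \<otimes> B\<close> is
  generated as a ring by the elements \<open>b \<otimes> 1\<close> and \<open>1 \<otimes> b\<close>.\<close>

lemma intertwine_from_gens:
  assumes \<phi>: "structural leg comult counit 2 n \<phi>" and \<psi>: "structural leg comult counit 2 n \<psi>"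
    and u: "u \<in> carrier (T n)"
    and gens: "\<And>p b. p \<in> {1, 2} \<Longrightarrow> b \<in> carrier B \<Longrightarrow>
      u \<otimes>\<^bsub>T n\<^esub> \<phi> (gen 2 p b) = \<psi> (gen 2 p b) \<otimes>\<^bsub>T n\<^esub> u"
    and X: "X \<in> carrier (T 2)"
  shows "u \<otimes>\<^bsub>T n\<^esub> \<phi> X = \<psi> X \<otimes>\<^bsub>T n\<^esub> u"
proof -
  interpret T: ring "T n" by (rule T_ring)
  note hom = structural_ring_hom[OF \<phi>] structural_ring_hom[OF \<psi>]
  note closed = ring_hom_closed[OF hom(1)] ring_hom_closed[OF hom(2)]
  define P where "P x \<longleftrightarrow> x \<in> carrier (T 2) \<and> u \<otimes>\<^bsub>T n\<^esub> \<phi> x = \<psi> x \<otimes>\<^bsub>T n\<^esub> u" for x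
  have mult: "P (x \<otimes>\<^bsub>T 2\<^esub> y)" if "P x" "P y" for x y
  proof -
    have xy: "x \<in> carrier (T 2)" "y \<in> carrier (T 2)"
      and eq: "u \<otimes>\<^bsub>T n\<^esub> \<phi> x = \<psi> x \<otimes>\<^bsub>T n\<^esub> u" "u \<otimes>\<^bsub>T n\<^esub> \<phi> y = \<psi> y \<otimes>\<^bsub>T n\<^esub> u"
      using that by (auto simp: P_def)
    have "u \<otimes>\<^bsub>T n\<^esub> (\<phi> x \<otimes>\<^bsub>T n\<^esub> \<phi> y) = u \<otimes>\<^bsub>T n\<^esub> \<phi> x \<otimes>\<^bsub>T n\<^esub> \<phi> y"
      using u xy closed by (simp add: T.m_assoc)
    also have "\<dots> = \<psi> x \<otimes>\<^bsub>T n\<^esub> (u \<otimes>\<^bsub>T n\<^esub> \<phi> y)"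
      using u xy closed by (simp add: eq(1) T.m_assoc)
    also have "\<dots> = \<psi> x \<otimes>\<^bsub>T n\<^esub> \<psi> y \<otimes>\<^bsub>T n\<^esub> u"
      using u xy closed by (simp add: eq(2) T.m_assoc)
    finally show ?thesis
      using xy ring.ring_simprules(5)[OF T_ring]
      by (simp add: P_def ring_hom_mult[OF hom(1)] ring_hom_mult[OF hom(2)])
  qed
  have add: "P (x \<oplus>\<^bsub>T 2\<^esub> y)" if "P x" "P y" for x y
    using that u closed ring.ring_simprules(1)[OF T_ring]
    by (simp add: P_def ring_hom_add[OF hom(1)] ring_hom_add[OF hom(2)] T.l_distr T.r_distr)
  have zero: "P \<zero>\<^bsub>T 2\<^esub>"
    using u ring.ring_simprules(2)[OF T_ring]
    by (simp add: P_def ring_hom_zero[OF hom(1) T_ring T_ring] ring_hom_zero[OF hom(2) T_ring T_ring])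
  have gen: "P (gen 2 p b)" if "p \<in> {1, 2}" "b \<in> carrier B" for p b
    using gens[OF that] gen_closed[OF that(2)] by (simp add: P_def)
  have "P (\<iota> 2 (tensor_class K B 2 s))" if "s \<in> formal_sums K B 2" for s
    using that
  proof (induction s)
    case Nil
    show ?case by (simp add: inclusion_zero zero)
  next
    case (Cons x s)
    obtain c a b where x: "x = (c, [a, b])" "c \<in> carrier K" "a \<in> carrier B" "b \<in> carrier B"
      using Cons.prems by (cases x) (auto simp: tensor_words_def length_Suc_conv numeral_2_eq_2)
    have s: "[x] \<in> formal_sums K B 2" "s \<in> formal_sums K B 2"
      using Cons.prems by (cases x, simp)+
    have "\<iota> 2 (tensor_class K B 2 (x # s)) =
        \<iota> 2 (tensor_class K B 2 [x] \<oplus>\<^bsub>tensor_power K B 2\<^esub> tensor_class K B 2 s)"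
      using s by (simp add: tensor_power_add)
    also have "\<dots> = \<iota> 2 (tensor_class K B 2 [x]) \<oplus>\<^bsub>T 2\<^esub> \<iota> 2 (tensor_class K B 2 s)"
      using s by (intro ring_hom_add[OF inclusion_ring_hom]) (auto simp: tensor_power_carrier)
    finally show ?case
      using Cons.IH s(2) x by (auto simp: inclusion_pure_tensor intro!: add mult gen)
  qed
  \<comment> \<open>The relation now holds on the image of the uncompleted square, and
    \<open>identities_preserved\<close> extends it to all of \<open>T 2\<close>.\<close>
  then have "u \<otimes>\<^bsub>T n\<^esub> \<phi> (\<iota> 2 x) = \<psi> (\<iota> 2 x) \<otimes>\<^bsub>T n\<^esub> u" if "x \<in> carrier (tensor_power K B 2)" for x
    using that by (auto simp: tensor_power_carrier P_def)
  with \<phi> \<psi> u show ?thesis using X by (rule identities_preserved)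
qed

text \<open>Equality of two structural maps is the intertwining relation with
  \<open>u = 1\<close>.\<close>

lemma eq_from_gens:
  assumes \<phi>: "structural leg comult counit 2 n \<phi>" and \<psi>: "structural leg comult counit 2 n \<psi>"
    and gens: "\<And>p b. p \<in> {1, 2} \<Longrightarrow> b \<in> carrier B \<Longrightarrow> \<phi> (gen 2 p b) = \<psi> (gen 2 p b)"
    and X: "X \<in> carrier (T 2)"
  shows "\<phi> X = \<psi> X"
proof -
  interpret T: ring "T n" by (rule T_ring)
  note closed = structural_ring_hom[OF \<phi>, THEN ring_hom_closed]
    structural_ring_hom[OF \<psi>, THEN ring_hom_closed]
  have "\<one>\<^bsub>T n\<^esub> \<otimes>\<^bsub>T n\<^esub> \<phi> X = \<psi> X \<otimes>\<^bsub>T n\<^esub> \<one>\<^bsub>T n\<^esub>"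
    using \<phi> \<psi> _ _ X
    by (rule intertwine_from_gens) (use gens closed gen_closed in auto)
  then show ?thesis using closed X by simp
qed

section \<open>Leg embeddings on the completions\<close>

lemma leg_gen:
  assumes "inj_on f {1..m}" "f ` {1..m} \<subseteq> {1..n}" "p \<in> {1..m}" "b \<in> carrier B"
  shows "leg m n f (gen m p b) = gen n (f p) b"
  using assms unfolding gen_def
  by (simp add: leg_extends gen_class_closed tensor_leg_class letter_at_closed leg_word_letter_at)

lemma at_legs_structural:
  assumes "i \<in> {1..n}" "j \<in> {1..n}" "i \<noteq> j"
  shows "structural leg comult counit 2 n (at_legs leg n i j)"
  unfolding at_legs_def using assms by (intro structural.leg) (auto simp: inj_on_def)

lemmas at_legs_hom = at_legs_structural[THEN structural_ring_hom]
lemmas at_legs_closed = at_legs_hom[THEN ring_hom_closed]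

lemma at_legs_gen:
  assumes "i \<in> {1..n}" "j \<in> {1..n}" "i \<noteq> j" "p \<in> {1, 2}" "b \<in> carrier B"
  shows "at_legs leg n i j (gen 2 p b) = gen n (if p = 1 then i else j) b"
  unfolding at_legs_def using assms by (subst leg_gen) (auto simp: inj_on_def)

lemma transpose_leg:
  assumes "i \<in> {1..n}" "j \<in> {1..n}"
  shows "inj_on (transpose i j) {1..n}" "transpose i j ` {1..n} \<subseteq> {1..n}"
  using assms by (auto simp: Transposition.transpose_def)

text \<open>Functoriality of the leg embeddings on the completion is derived: both sides are
  structural maps on \<open>T 2\<close>, and on generators each only moves the position of one
  letter.\<close>

lemma leg_at_legs:
  assumes f: "inj_on f {1..m}" "f ` {1..m} \<subseteq> {1..n}"
    and ij: "i \<in> {1..m}" "j \<in> {1..m}" "i \<noteq> j" and X: "X \<in> carrier (T 2)"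
  shows "leg m n f (at_legs leg m i j X) = at_legs leg n (f i) (f j) X"
proof -
  have fij: "f i \<in> {1..n}" "f j \<in> {1..n}" "f i \<noteq> f j"
    using f ij by (blast, blast, meson inj_onD)
  have "(leg m n f \<circ> at_legs leg m i j) X = at_legs leg n (f i) (f j) X"
    using structural.comp[OF at_legs_structural[OF ij] structural.leg[OF f]]
      at_legs_structural[OF fij] _ X
  proof (rule eq_from_gens)
    fix p :: nat and b assume "p \<in> {1, 2}" "b \<in> carrier B"
    with ij fij show "(leg m n f \<circ> at_legs leg m i j) (gen 2 p b) = at_legs leg n (f i) (f j) (gen 2 p b)"
      by (auto simp: at_legs_gen[OF ij] at_legs_gen[OF fij] leg_gen[OF f] simp del: One_nat_def)
  qed
  then show ?thesis by simp
qed

lemma at_legs_flip: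
  assumes ij: "i \<in> {1..n}" "j \<in> {1..n}" "i \<noteq> j" and X: "X \<in> carrier (T 2)"
  shows "at_legs leg n i j (leg 2 2 (transpose 1 2) X) = at_legs leg n j i X"
proof -
  have t: "inj_on (transpose 1 2) {1..2::nat}" "transpose 1 2 ` {1..2} \<subseteq> {1..2::nat}"
    by (rule transpose_leg; simp)+
  have "(at_legs leg n i j \<circ> leg 2 2 (transpose 1 2)) X = at_legs leg n j i X"
    using structural.comp[OF structural.leg[OF t] at_legs_structural[OF ij]]
      at_legs_structural[OF ij(2,1) ij(3)[symmetric]] _ X
  proof (rule eq_from_gens)
    fix p :: nat and b assume p: "p \<in> {1, 2}" and b: "b \<in> carrier B"
    then have "leg 2 2 (transpose 1 2) (gen 2 p b) = gen 2 (transpose 1 2 p) b"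
      by (intro leg_gen[OF t]) auto
    with p b ij show "(at_legs leg n i j \<circ> leg 2 2 (transpose 1 2)) (gen 2 p b) = at_legs leg n j i (gen 2 p b)"
      by (auto simp: at_legs_gen)
  qed
  then show ?thesis by simp
qed

text \<open>In every position at least one of the two letters is 1, so the componentwise products
  agree.\<close>

lemma gen_commute:
  assumes "a \<in> carrier B" "b \<in> carrier B" "p \<in> {1..n}" "q \<in> {1..n}" "p \<noteq> q"
  shows "gen n p a \<otimes>\<^bsub>T n\<^esub> gen n q b = gen n q b \<otimes>\<^bsub>T n\<^esub> gen n p a"
proof -
  have "p - 1 \<noteq> q - 1" "p - 1 < n" "q - 1 < n" using assms by auto
  then have "map2 (\<otimes>\<^bsub>B\<^esub>) (letter_at n p a) (letter_at n q b) =
      map2 (\<otimes>\<^bsub>B\<^esub>) (letter_at n q b) (letter_at n p a)"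
    using assms(1,2) by (intro nth_equalityI) (auto simp: letter_at_def nth_list_update)
  then show ?thesis
    using assms(1,2) unfolding gen_def
    by (simp add: ring_hom_mult[OF inclusion_ring_hom, symmetric] gen_class_closed
        tensor_power_mult letter_at_closed formal_mult_def)
qed

text \<open>Commuting with \<open>gen n p b\<close> is an intertwining relation in which both maps
  are the same leg embedding. It follows from the generators, although \<open>X\<close> may lie
  outside the algebraic tensor square.\<close>

lemma at_legs_commute_gen:
  assumes "i \<in> {1..n}" "j \<in> {1..n}" "p \<in> {1..n}" "i \<noteq> j" "p \<noteq> i" "p \<noteq> j"
    and b: "b \<in> carrier B" and X: "X \<in> carrier (T 2)"
  shows "gen n p b \<otimes>\<^bsub>T n\<^esub> at_legs leg n i j X = at_legs leg n i j X \<otimes>\<^bsub>T n\<^esub> gen n p b"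
  using at_legs_structural[OF assms(1,2,4)] at_legs_structural[OF assms(1,2,4)] gen_closed[OF b] _ X
  by (rule intertwine_from_gens) (use assms in \<open>auto simp: at_legs_gen gen_commute\<close>)

section \<open>The comultiplication on generators\<close>

lemma leg_word_2_3:
  assumes "v \<in> tensor_words B 2"
  shows "leg_word 2 3 (\<lambda>s. if s = 1 then 1 else 2) v = v @ [\<one>\<^bsub>B\<^esub>]"
    and "leg_word 2 3 (\<lambda>s. if s = 1 then 2 else 3) v = \<one>\<^bsub>B\<^esub> # v"
proof -
  obtain x y where v: "v = [x, y]"
    using assms by (auto simp: tensor_words_def length_Suc_conv numeral_2_eq_2)
  have list3: "xs = [xs ! 0, xs ! 1, xs ! 2]" if "length xs = 3" for xs :: "'b list"
    using that by (auto simp: length_Suc_conv numeral_3_eq_3 numeral_2_eq_2)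
  let ?f = "\<lambda>s::nat. if s = 1 then 1 else 2 :: nat" and ?g = "\<lambda>s::nat. if s = 1 then 2 else 3 :: nat"
  have f: "inj_on ?f {1..2}" "?f ` {1..2} \<subseteq> {1..3}" and g: "inj_on ?g {1..2}" "?g ` {1..2} \<subseteq> {1..3}"
    by (auto simp: inj_on_def)
  have outside: "3 \<notin> ?f ` {1..2}" "1 \<notin> ?g ` {1..2}" by auto
  show "leg_word 2 3 ?f v = v @ [\<one>\<^bsub>B\<^esub>]"
    using leg_word_nth[OF f, of 1 v] leg_word_nth[OF f, of 2 v] leg_word_nth_outside[OF _ outside(1), of 3 v]
    by (subst list3) (auto simp: v)
  show "leg_word 2 3 ?g v = \<one>\<^bsub>B\<^esub> # v"
    using leg_word_nth[OF g, of 1 v] leg_word_nth[OF g, of 2 v] leg_word_nth_outside[OF _ outside(2), of 3 v]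
    by (subst list3) (auto simp: v)
qed

lemma comult_gen:
  assumes b: "b \<in> carrier B" and "i \<in> {1..2}" "p \<in> {1..2}"
  shows "comult 2 i (gen 2 p b) =
    \<iota> 3 (tensor_class K B 3 (formal_comult i [(\<one>\<^bsub>K\<^esub>, letter_at 2 p b)]))"
  using assms unfolding gen_def
  by (simp add: comult_extends gen_class_closed tensor_comult_class letter_at_closed)

text \<open>Here the comultiplied factor is 1 and \<open>\<Delta>\<close> is unital. The letter
  \<open>b\<close> moves to position 3 if it stands to the right of that factor, and stays in
  position 1 if it stands to the left.\<close>

lemma comult_gen_other:
  assumes b: "b \<in> carrier B"
  shows "comult 2 1 (gen 2 2 b) = gen 3 3 b" and "comult 2 2 (gen 2 1 b) = gen 3 1 b"
proof -
  have "tensor_eq K B 3 (pad \<one>\<^bsub>K\<^esub> [] [b] (comult_rep \<one>\<^bsub>B\<^esub>)) (pad \<one>\<^bsub>K\<^esub> [] [b] [(\<one>\<^bsub>K\<^esub>, [\<one>\<^bsub>B\<^esub>, \<one>\<^bsub>B\<^esub>])])"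
    "tensor_eq K B 3 (pad \<one>\<^bsub>K\<^esub> [b] [] (comult_rep \<one>\<^bsub>B\<^esub>)) (pad \<one>\<^bsub>K\<^esub> [b] [] [(\<one>\<^bsub>K\<^esub>, [\<one>\<^bsub>B\<^esub>, \<one>\<^bsub>B\<^esub>])])"
    using b by (auto intro!: pad_cong[OF comult_rep_one])
  note eq = this[THEN tensor_class_cong]
  have "comult 2 1 (gen 2 2 b) = \<iota> 3 (tensor_class K B 3 (pad \<one>\<^bsub>K\<^esub> [] [b] (comult_rep \<one>\<^bsub>B\<^esub>)))"
    using b by (subst comult_gen) (simp_all add: formal_comult_def letter_at_simps)
  then show "comult 2 1 (gen 2 2 b) = gen 3 3 b"
    unfolding eq by (simp add: pad_def gen_def letter_at_simps)
  have "comult 2 2 (gen 2 1 b) = \<iota> 3 (tensor_class K B 3 (pad \<one>\<^bsub>K\<^esub> [b] [] (comult_rep \<one>\<^bsub>B\<^esub>)))"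
    using b by (subst comult_gen) (simp_all add: formal_comult_def letter_at_simps del: One_nat_def)
  then show "comult 2 2 (gen 2 1 b) = gen 3 1 b"
    unfolding eq by (simp add: pad_def gen_def letter_at_simps del: One_nat_def)
qed

lemma inclusion_comult_closed:
  assumes "b \<in> carrier B"
  shows "\<iota> 2 (\<Delta> b) \<in> carrier (T 2)"
  using comult_rep[OF assms]
  by (intro ring_hom_closed[OF inclusion_ring_hom]) (auto simp: tensor_power_carrier)

text \<open>The remaining letter is 1, and padding a representative of \<open>\<Delta> b\<close>
  with 1 on one side is the leg embedding into two neighbouring positions.\<close>

lemma comult_gen_same:
  assumes b: "b \<in> carrier B"
  shows "comult 2 1 (gen 2 1 b) = at_legs leg 3 1 2 (\<iota> 2 (\<Delta> b))"
    and "comult 2 2 (gen 2 2 b) = at_legs leg 3 2 3 (\<iota> 2 (\<Delta> b))"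
proof -
  have rep: "\<one>\<^bsub>K\<^esub> \<otimes>\<^bsub>K\<^esub> c = c" "v \<in> tensor_words B 2" if "(c, v) \<in> set (comult_rep b)" for c v
    using formal_sums_memD[OF comult_rep(1)[OF b] that] by auto
  have eq: "pad \<one>\<^bsub>K\<^esub> [] [\<one>\<^bsub>B\<^esub>] (comult_rep b) =
      map (\<lambda>(c, w). (c, leg_word 2 3 (\<lambda>s. if s = 1 then 1 else 2) w)) (comult_rep b)"
    "pad \<one>\<^bsub>K\<^esub> [\<one>\<^bsub>B\<^esub>] [] (comult_rep b) =
      map (\<lambda>(c, w). (c, leg_word 2 3 (\<lambda>s. if s = 1 then 2 else 3) w)) (comult_rep b)"
    by (auto simp: pad_def rep leg_word_2_3[OF rep(2)] simp del: One_nat_def)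
  have legs: "at_legs leg 3 i j (\<iota> 2 (\<Delta> b)) = \<iota> 3 (tensor_class K B 3
      (map (\<lambda>(c, w). (c, leg_word 2 3 (\<lambda>s. if s = 1 then i else j) w)) (comult_rep b)))"
    if "i \<in> {1..3}" "j \<in> {1..3}" "i \<noteq> j" for i j
  proof -
    have f: "inj_on (\<lambda>s. if s = 1 then i else j) {1..2::nat}"
      "(\<lambda>s. if s = 1 then i else j) ` {1..2::nat} \<subseteq> {1..3}"
      using that by (auto simp: inj_on_def)
    show ?thesis
      using comult_rep[OF b] unfolding at_legs_def
      by (simp only: leg_extends[OF f] tensor_leg_class[OF f] tensor_power_carrier image_eqI)
  qed
  have "comult 2 1 (gen 2 1 b) = \<iota> 3 (tensor_class K B 3 (pad \<one>\<^bsub>K\<^esub> [] [\<one>\<^bsub>B\<^esub>] (comult_rep b)))"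
    using b by (subst comult_gen) (simp_all add: formal_comult_def letter_at_simps(1)[simplified])
  then show "comult 2 1 (gen 2 1 b) = at_legs leg 3 1 2 (\<iota> 2 (\<Delta> b))"
    unfolding eq by (subst legs) simp_all
  have "comult 2 2 (gen 2 2 b) = \<iota> 3 (tensor_class K B 3 (pad \<one>\<^bsub>K\<^esub> [\<one>\<^bsub>B\<^esub>] [] (comult_rep b)))"
    using b by (subst comult_gen) (simp_all add: formal_comult_def letter_at_simps)
  then show "comult 2 2 (gen 2 2 b) = at_legs leg 3 2 3 (\<iota> 2 (\<Delta> b))"
    unfolding eq by (subst legs) simp_all
qed

section \<open>Intertwining relations of R-matrices\<close>

lemma R_matrix_closed: "R_matrix B \<Delta> T \<iota> leg comult R \<Longrightarrow> R \<in> carrier (T 2)"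
  by (auto simp: R_matrix_def Units_def)

text \<open>Multiplying the conjugation formula by \<open>R\<close> on the right frees it of the
  inverse. The homomorphism \<open>at_legs leg n i j\<close> then carries it to \<open>n\<close>
  factors, where the flip becomes the exchange of \<open>i\<close> and \<open>j\<close>.\<close>

lemma at_legs_R_matrix_comult:
  assumes R: "R_matrix B \<Delta> T \<iota> leg comult R" and b: "b \<in> carrier B"
    and ij: "i \<in> {1..n}" "j \<in> {1..n}" "i \<noteq> j"
  shows "at_legs leg n i j R \<otimes>\<^bsub>T n\<^esub> at_legs leg n i j (\<iota> 2 (\<Delta> b)) =
    at_legs leg n j i (\<iota> 2 (\<Delta> b)) \<otimes>\<^bsub>T n\<^esub> at_legs leg n i j R"
proof -
  interpret T: ring "T 2" by (rule T_ring)
  let ?x = "\<iota> 2 (\<Delta> b)" and ?\<tau> = "leg 2 2 (transpose 1 2)"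
  note x = inclusion_comult_closed[OF b]
  note Rc = R_matrix_closed[OF R]
  have Ru: "R \<in> Units (T 2)" and \<tau>: "?\<tau> ?x = R \<otimes>\<^bsub>T 2\<^esub> ?x \<otimes>\<^bsub>T 2\<^esub> inv\<^bsub>T 2\<^esub> R"
    using R b by (auto simp: R_matrix_def)
  have "?\<tau> ?x \<otimes>\<^bsub>T 2\<^esub> R = R \<otimes>\<^bsub>T 2\<^esub> ?x"
    using Ru Rc x by (simp only: \<tau>) (simp add: T.m_assoc)
  moreover have "?\<tau> ?x \<in> carrier (T 2)"
    using Ru Rc x by (simp only: \<tau>) simp
  ultimately show ?thesis
    using Rc x by (simp only: ring_hom_mult[OF at_legs_hom[OF ij], symmetric] at_legs_flip[OF ij, symmetric])
qed

text \<open>Taking \<open>i\<close> to be 1 or 2 treats both comultiplications at once: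
  comultiplying the factor \<open>i\<close> fills the legs \<open>i\<close> and
  \<open>Suc i\<close>, on which \<open>R\<close> acts. It is enough to test generators, as both
  maps are structural.\<close>

lemma R_matrix_intertwines_comult:
  assumes R: "R_matrix B \<Delta> T \<iota> leg comult R" and X: "X \<in> carrier (T 2)" and i: "i \<in> {1, 2}"
  shows "at_legs leg 3 i (Suc i) R \<otimes>\<^bsub>T 3\<^esub> comult 2 i X =
    leg 3 3 (transpose i (Suc i)) (comult 2 i X) \<otimes>\<^bsub>T 3\<^esub> at_legs leg 3 i (Suc i) R"
proof -
  have legs: "i \<in> {1..3}" "Suc i \<in> {1..3}" "i \<noteq> Suc i" using i by auto
  note t = transpose_leg[OF legs(1,2)]
  have c: "structural leg comult counit 2 3 (comult 2 i)"
    using structural.comult[of i 2] i by auto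
  have u: "at_legs leg 3 i (Suc i) R \<in> carrier (T 3)"
    using R_matrix_closed[OF R] legs by (intro at_legs_closed)
  have "at_legs leg 3 i (Suc i) R \<otimes>\<^bsub>T 3\<^esub> comult 2 i X =
      (leg 3 3 (transpose i (Suc i)) \<circ> comult 2 i) X \<otimes>\<^bsub>T 3\<^esub> at_legs leg 3 i (Suc i) R"
    using c structural.comp[OF c structural.leg[OF t]] u _ X
  proof (rule intertwine_from_gens)
    fix p :: nat and b assume p: "p \<in> {1, 2}" and b: "b \<in> carrier B"
    show "at_legs leg 3 i (Suc i) R \<otimes>\<^bsub>T 3\<^esub> comult 2 i (gen 2 p b) =
      (leg 3 3 (transpose i (Suc i)) \<circ> comult 2 i) (gen 2 p b) \<otimes>\<^bsub>T 3\<^esub> at_legs leg 3 i (Suc i) R"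
    proof (cases "p = i")
      case True
      have "comult 2 i (gen 2 p b) = at_legs leg 3 i (Suc i) (\<iota> 2 (\<Delta> b))"
        using comult_gen_same[OF b] i True by (auto simp: numeral_2_eq_2 numeral_3_eq_3)
      then show ?thesis
        using at_legs_R_matrix_comult[OF R b legs]
          leg_at_legs[OF t legs inclusion_comult_closed[OF b]] by simp
    next
      case False
      \<comment> \<open>The position \<open>q\<close> is the leg not touched by \<open>R\<close>: 3
        for \<open>i = 1\<close> and 1 for \<open>i = 2\<close>. The transposition fixes it, and
        \<open>R\<close> commutes with what stands there.\<close>
      then obtain q where q: "q \<in> {1..3}" "q \<noteq> i" "q \<noteq> Suc i" "comult 2 i (gen 2 p b) = gen 3 q b"
        using comult_gen_other[OF b] i p by fastforce
      have "leg 3 3 (transpose i (Suc i)) (gen 3 q b) = gen 3 q b"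
        using leg_gen[OF t q(1) b] q by simp
      then show ?thesis
        using at_legs_commute_gen[OF legs(1,2) q(1) legs(3) q(2,3) b R_matrix_closed[OF R]] q(4)
        by simp
    qed
  qed
  then show ?thesis by simp
qed

text \<open>The matrix \<open>R\<close> occurs twice because it is the one being comultiplied, while
  \<open>S\<close> supplies the intertwining relation.\<close>

lemma Yang_Baxter_3:
  assumes R: "R_matrix B \<Delta> T \<iota> leg comult R" and S: "R_matrix B \<Delta> T \<iota> leg comult S"
  shows "at_legs leg 3 2 3 R \<otimes>\<^bsub>T 3\<^esub> at_legs leg 3 1 3 R \<otimes>\<^bsub>T 3\<^esub> at_legs leg 3 1 2 S =
      at_legs leg 3 1 2 S \<otimes>\<^bsub>T 3\<^esub> at_legs leg 3 1 3 R \<otimes>\<^bsub>T 3\<^esub> at_legs leg 3 2 3 R"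
    and "at_legs leg 3 2 3 S \<otimes>\<^bsub>T 3\<^esub> at_legs leg 3 1 3 R \<otimes>\<^bsub>T 3\<^esub> at_legs leg 3 1 2 R =
      at_legs leg 3 1 2 R \<otimes>\<^bsub>T 3\<^esub> at_legs leg 3 1 3 R \<otimes>\<^bsub>T 3\<^esub> at_legs leg 3 2 3 S"
proof -
  interpret T: ring "T 3" by (rule T_ring)
  note c = R_matrix_closed[OF R] R_matrix_closed[OF S]
  have closed: "at_legs leg 3 i j X \<in> carrier (T 3)"
    if "X \<in> carrier (T 2)" "i \<in> {1..3}" "j \<in> {1..3}" "i \<noteq> j" for X i j
    using that by (intro at_legs_closed)
  have t: "inj_on (transpose 1 2) {1..3::nat}" "transpose 1 2 ` {1..3} \<subseteq> {1..3::nat}"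
    "inj_on (transpose 2 3) {1..3::nat}" "transpose 2 3 ` {1..3} \<subseteq> {1..3::nat}"
    by (rule transpose_leg; simp)+
  have comult: "comult 2 1 R = at_legs leg 3 1 3 R \<otimes>\<^bsub>T 3\<^esub> at_legs leg 3 2 3 R"
    "comult 2 2 R = at_legs leg 3 1 3 R \<otimes>\<^bsub>T 3\<^esub> at_legs leg 3 1 2 R"
    using R by (simp_all add: R_matrix_def)
  have hom: "leg 3 3 (transpose 1 2) \<in> ring_hom (T 3) (T 3)"
    "leg 3 3 (transpose 2 3) \<in> ring_hom (T 3) (T 3)"
    by (intro structural_ring_hom structural.leg t)+
  \<comment> \<open>Transposing the legs of \<open>S\<close> exchanges the two leg pairs occupied by
    \<open>R\<close>, so the two factors trade places.\<close>
  have flip: "leg 3 3 (transpose 1 2) (comult 2 1 R) = at_legs leg 3 2 3 R \<otimes>\<^bsub>T 3\<^esub> at_legs leg 3 1 3 R"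
    "leg 3 3 (transpose 2 3) (comult 2 2 R) = at_legs leg 3 1 2 R \<otimes>\<^bsub>T 3\<^esub> at_legs leg 3 1 3 R"
    using c by (simp_all add: comult ring_hom_mult[OF hom(1)] ring_hom_mult[OF hom(2)] closed
        leg_at_legs[OF t(1,2)] leg_at_legs[OF t(3,4)] del: One_nat_def)
  show "at_legs leg 3 2 3 R \<otimes>\<^bsub>T 3\<^esub> at_legs leg 3 1 3 R \<otimes>\<^bsub>T 3\<^esub> at_legs leg 3 1 2 S =
      at_legs leg 3 1 2 S \<otimes>\<^bsub>T 3\<^esub> at_legs leg 3 1 3 R \<otimes>\<^bsub>T 3\<^esub> at_legs leg 3 2 3 R"
    using R_matrix_intertwines_comult[OF S c(1), of 1, unfolded Suc_1] c unfolding flip unfolding comult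
    by (simp add: closed T.m_assoc del: One_nat_def)
  show "at_legs leg 3 2 3 S \<otimes>\<^bsub>T 3\<^esub> at_legs leg 3 1 3 R \<otimes>\<^bsub>T 3\<^esub> at_legs leg 3 1 2 R =
      at_legs leg 3 1 2 R \<otimes>\<^bsub>T 3\<^esub> at_legs leg 3 1 3 R \<otimes>\<^bsub>T 3\<^esub> at_legs leg 3 2 3 S"
    using R_matrix_intertwines_comult[OF S c(1), of 2, unfolded Suc_numeral add_num_simps] c unfolding flip unfolding comult
    by (simp add: closed T.m_assoc del: One_nat_def)
qed

end

theorem proposition2p23:
  fixes K :: "'k ring" and B :: "('k, 'b) module"
    and \<Delta> :: "'b \<Rightarrow> ('k, 'b) formal_sum set" and \<epsilon> :: "'b \<Rightarrow> 'k"
    and T :: "nat \<Rightarrow> ('k, 'a) module"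
    and \<iota> :: "nat \<Rightarrow> ('k, 'b) formal_sum set \<Rightarrow> 'a"
    and leg :: "nat \<Rightarrow> nat \<Rightarrow> (nat \<Rightarrow> nat) \<Rightarrow> 'a \<Rightarrow> 'a"
    and comult counit :: "nat \<Rightarrow> nat \<Rightarrow> 'a \<Rightarrow> 'a"
    and C :: "'c set" and R :: "'c \<Rightarrow> 'a" and n i j k :: nat and c c' c'' :: 'c
  assumes "completed_tensor_powers K B \<Delta> \<epsilon> T \<iota> leg comult counit"
    and "\<And>d. d \<in> C \<Longrightarrow> R_matrix B \<Delta> T \<iota> leg comult (R d)"
    and "i \<in> {1..n}" "j \<in> {1..n}" "k \<in> {1..n}"
    and "i \<noteq> j" "i \<noteq> k" "j \<noteq> k"
    and "c \<in> C" "c' \<in> C" "c'' \<in> C"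
    and "c' \<in> {c, c''}"
  shows "at_legs leg n j k (R c) \<otimes>\<^bsub>T n\<^esub> at_legs leg n i k (R c') \<otimes>\<^bsub>T n\<^esub> at_legs leg n i j (R c'') =
    at_legs leg n i j (R c'') \<otimes>\<^bsub>T n\<^esub> at_legs leg n i k (R c') \<otimes>\<^bsub>T n\<^esub> at_legs leg n j k (R c)"
proof -
  interpret completed_tensor_powers K B \<Delta> \<epsilon> T \<iota> leg comult counit by (rule assms(1))
  \<comment> \<open>Only the values on \<open>{1..3}\<close> matter; the last branch serves
    \<open>s = 3\<close>.\<close>
  define f where "f s = (if s = 1 then i else if s = 2 then j else k)" for s :: nat
  have f: "inj_on f {1..3}" "f ` {1..3} \<subseteq> {1..n}"
    using assms(3-8) by (auto simp: f_def inj_on_def)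
  have f_simps: "f 1 = i" "f 2 = j" "f 3 = k"
    by (simp_all add: f_def)
  have hom: "leg 3 n f \<in> ring_hom (T 3) (T n)"
    using f by (intro structural_ring_hom structural.leg)
  interpret T: ring "T 3" by (rule T_ring)
  have R: "R d \<in> carrier (T 2)" if "d \<in> C" for d
    using R_matrix_closed assms(2) that by blast
  \<comment> \<open>If \<open>c' = c\<close>, this is the first equation with \<open>R c\<close>
    comultiplied and \<open>R c''\<close> intertwining; if \<open>c' = c''\<close>, it is the second
    one with these roles exchanged.\<close>
  have "at_legs leg 3 2 3 (R c) \<otimes>\<^bsub>T 3\<^esub> at_legs leg 3 1 3 (R c') \<otimes>\<^bsub>T 3\<^esub> at_legs leg 3 1 2 (R c'') =
      at_legs leg 3 1 2 (R c'') \<otimes>\<^bsub>T 3\<^esub> at_legs leg 3 1 3 (R c') \<otimes>\<^bsub>T 3\<^esub> at_legs leg 3 2 3 (R c)"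
    using Yang_Baxter_3[OF assms(2) assms(2)] assms(9-12) by blast
  then have "leg 3 n f (at_legs leg 3 2 3 (R c) \<otimes>\<^bsub>T 3\<^esub> at_legs leg 3 1 3 (R c') \<otimes>\<^bsub>T 3\<^esub> at_legs leg 3 1 2 (R c'')) =
      leg 3 n f (at_legs leg 3 1 2 (R c'') \<otimes>\<^bsub>T 3\<^esub> at_legs leg 3 1 3 (R c') \<otimes>\<^bsub>T 3\<^esub> at_legs leg 3 2 3 (R c))"
    by simp
  then show ?thesis
    using assms(9-11)
    by (simp add: ring_hom_mult[OF hom] at_legs_closed leg_at_legs[OF f] R f_simps del: One_nat_def)
qed

end
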